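(* Let $X$ be a nonempty set and let $\alpha,\beta\in T(X)$. Then $\alpha\sim_c\beta$ in $T(X)$ if and only if exactly one of the following conditions is satisfied: (1) both $\alpha$ and $\beta$ have a cycle and $\mathrm{cs}(\alpha)=\mathrm{cs}(\beta)$; (2) both $\alpha$ and $\beta$ have a double ray but no cycles; (3) all connected components of both $\alpha$ and $\beta$ have type $rro$ and: (a) for every connected component $\gamma$ of $\alpha$, there is a connected component $\delta$ of $\beta$ such that $\langle\xi^\delta_n\rangle$ dominates $\langle\eta^\gamma_n\rangle$ for some maximal right ray $\eta$ in $\gamma$ and some maximal right ray $\xi$ in $\delta$, and (b) for every connected component $\delta$ of $\beta$, there is a connected component $\gamma$ of $\alpha$ such that $\langle\eta^\gamma_n\rangle$ dominates $\langle\xi^\delta_n\rangle$ for some maximal right ray $\xi$ in $\delta$ and some maximal right ray $\eta$ in $\gamma$.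
   Context: Conjugacy. For a semigroup $S$, $S^1$ is $S$ if $S$ is a monoid, and $S$ with an identity adjoined otherwise. If $S$ has a zero $0$ and $0\ne a\in S$, let $\mathbb{P}(a)=\{g\in S:(ma)g\neq 0\text{ for all }ma\in S^1a\setminus\{0\}\}$, and $\mathbb{P}(0)=\{0\}$; if $S$ has no zero, $\mathbb{P}(a)=S$ for all $a$. Put $\mathbb{P}^1(a)=\mathbb{P}(a)\cup\{1\}$. Then $a\sim_c b$ iff there are $g\in\mathbb{P}^1(a)$, $h\in\mathbb{P}^1(b)$ with $ag=gb$ and $bh=ha$. Transformations. $P(X)$ is the semigroup of all partial maps from $X$ to $X$, written on the right and composed left to right; $T(X)$ is its subsemigroup of full maps ($\mathrm{dom}(\alpha)=X$). Write $x\alpha=\diamond$ (with $\diamond\notin X$) if $x\notin\mathrm{dom}(\alpha)$, and $\diamond\alpha=\diamond$. $\mathrm{span}(\alpha)=\mathrm{dom}(\alpha)\cup\mathrm{im}(\alpha)$. Basic partial transformations (all listed $x_i$ distinct; each map is defined only by the displayed arrows $x\to x\sigma$): a cycle of length $k\ge1$: $x_0\to x_1\to\cdots\to x_{k-1}\to x_0$; a right ray: $x_0\to x_1\to x_2\to\cdots$; a double ray: $\cdots\to x_{-1}\to x_0\to x_1\to\cdots$; a left ray: $\cdots\to x_2\to x_1\to x_0$; a chain of length $k\geq1$: $x_0\to x_1\to\cdots\to x_k$. $\beta$ is contained in $\alpha$ (also: $\alpha$ has $\beta$) if $\mathrm{dom}(\beta)\subseteq\mathrm{dom}(\alpha)$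 and $x\beta=x\alpha$ for all $x\in\mathrm{dom}(\beta)$. A basic $\mu$ contained in $\alpha$ is maximal in $\alpha$ if for every $x\in\mathrm{span}(\mu)$: $x\notin\mathrm{dom}(\mu)$ implies $x\notin\mathrm{dom}(\alpha)$, and $x\notin\mathrm{im}(\mu)$ implies $x\notin\mathrm{im}(\alpha)$. Connectedness. $\gamma\in P(X)$ is connected if $\gamma\neq0$ (the empty map) and for all $x,y\in\mathrm{span}(\gamma)$ there are $k,m\geq0$ with $x\gamma^k=y\gamma^m\neq\diamond$ ($\gamma^0=\mathrm{id}_X$). Every nonzero $\alpha\in P(X)$ is uniquely the join (union) of a set of connected elements of $P(X)$ contained in $\alpha$ with pairwise disjoint spans; these are the connected components of $\alpha$. A connected $\gamma$ has type $rro$ if it has a maximal right ray but no cycles, double rays, left rays, or maximal chains. Rank. If $\gamma$ is connected of type $rro$, the relation $\{(y,x):y\gamma=x\}$ on $\mathrm{span}(\gamma)$ is well founded; $\rho_\gamma(x)$ is the ordinal rank $\rho_\gamma(x)=\sup\{\rho_\gamma(y)+1:y\gamma=x\}$. For a maximal right ray $\eta=[x_0\,x_1\,x_2\ldots\rangle$ in $\gamma$, $\eta^\gamma_n=\rho_\gamma(x_n)$ for $n\ge0$. A sequence of ordinals $\langle b_n\rangle_{n\geq0}$ dominates $\langle a_n\rangle_{n\geq0}$ if there is $k\geq0$ with $b_{k+n}\geq a_n$ for all $n\geq0$. Cycle set. If $\alpha$ has a cycle and $M$ is the set of lengths of cycles in $\alpha$, then $\mathrm{cs}(\alpha)$ is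 the set of $m\in M$ that are not multiples of any smaller element of $M$. *)

theory Defs
  imports Main
begin

section \<open>Conjugacy in a semigroup\<close>

text \<open>
  A semigroup is given by a carrier set \<open>S\<close> and an operation \<open>f\<close>.  The monoid \<open>S\<^sup>1\<close> lives on the
  option type: \<open>Some s\<close> is the element \<open>s\<close> of \<open>S\<close>, and \<open>None\<close> is the adjoined identity, which
  belongs to \<open>S\<^sup>1\<close> only if \<open>S\<close> has no identity of its own.
\<close>

definition sg_identity :: "'s set \<Rightarrow> ('s \<Rightarrow> 's \<Rightarrow> 's) \<Rightarrow> 's \<Rightarrow> bool" where
  "sg_identity S f e \<longleftrightarrow> e \<in> S \<and> (\<forall>x\<in>S. f e x = x \<and> f x e = x)"

definition sg_zero :: "'s set \<Rightarrow> ('s \<Rightarrow> 's \<Rightarrow> 's) \<Rightarrow> 's \<Rightarrow> bool" where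
  "sg_zero S f z \<longleftrightarrow> z \<in> S \<and> (\<forall>x\<in>S. f z x = z \<and> f x z = z)"

definition monoid_ext :: "'s set \<Rightarrow> ('s \<Rightarrow> 's \<Rightarrow> 's) \<Rightarrow> 's option set" where
  "monoid_ext S f =
     (if \<exists>e. sg_identity S f e then Some ` S else insert None (Some ` S))"

definition one_ext :: "'s set \<Rightarrow> ('s \<Rightarrow> 's \<Rightarrow> 's) \<Rightarrow> 's option" where
  "one_ext S f =
     (if \<exists>e. sg_identity S f e then Some (THE e. sg_identity S f e) else None)"

fun mult_ext :: "('s \<Rightarrow> 's \<Rightarrow> 's) \<Rightarrow> 's option \<Rightarrow> 's option \<Rightarrow> 's option" where
  "mult_ext f None y = y"
| "mult_ext f (Some x) None = Some x"
| "mult_ext f (Some x) (Some y) = Some (f x y)"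

definition PP :: "'s set \<Rightarrow> ('s \<Rightarrow> 's \<Rightarrow> 's) \<Rightarrow> 's \<Rightarrow> 's set" where
  "PP S f a =
     (if \<exists>z. sg_zero S f z then
        (let z = (THE z. sg_zero S f z) in
         if a = z then {z}
         else {g \<in> S. \<forall>m \<in> monoid_ext S f.
                 mult_ext f m (Some a) \<noteq> Some z \<longrightarrow>
                 mult_ext f (mult_ext f m (Some a)) (Some g) \<noteq> Some z})
      else S)"

definition PP1 :: "'s set \<Rightarrow> ('s \<Rightarrow> 's \<Rightarrow> 's) \<Rightarrow> 's \<Rightarrow> 's option set" where
  "PP1 S f a = insert (one_ext S f) (Some ` PP S f a)"

definition conj_c :: "'s set \<Rightarrow> ('s \<Rightarrow> 's \<Rightarrow> 's) \<Rightarrow> 's \<Rightarrow> 's \<Rightarrow> bool" where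
  "conj_c S f a b \<longleftrightarrow>
     (\<exists>g \<in> PP1 S f a. \<exists>h \<in> PP1 S f b.
        mult_ext f (Some a) g = mult_ext f g (Some b) \<and>
        mult_ext f (Some b) h = mult_ext f h (Some a))"


section \<open>Partial transformations\<close>

text \<open>Partial maps are elements of \<open>'a \<rightharpoonup> 'a\<close>; the value \<open>None\<close> plays the role of \<open>\<diamond>\<close>.\<close>

definition partial_trans :: "'a set \<Rightarrow> ('a \<rightharpoonup> 'a) set" where
  "partial_trans X = {\<alpha>. dom \<alpha> \<subseteq> X \<and> ran \<alpha> \<subseteq> X}"

definition full_trans :: "'a set \<Rightarrow> ('a \<rightharpoonup> 'a) set" where
  "full_trans X = {\<alpha> \<in> partial_trans X. dom \<alpha> = X}"

text \<open>Left-to-right composition: first \<open>\<alpha>\<close>, then \<open>\<beta>\<close>.\<close>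

definition pcomp :: "('a \<rightharpoonup> 'a) \<Rightarrow> ('a \<rightharpoonup> 'a) \<Rightarrow> ('a \<rightharpoonup> 'a)" where
  "pcomp \<alpha> \<beta> = \<beta> \<circ>\<^sub>m \<alpha>"

text \<open>The zeroth power is the identity on the whole type; powers are only ever applied to points of
  the span, where this agrees with the identity on the underlying set.\<close>

fun ppow :: "('a \<rightharpoonup> 'a) \<Rightarrow> nat \<Rightarrow> ('a \<rightharpoonup> 'a)" where
  "ppow \<gamma> 0 = Some"
| "ppow \<gamma> (Suc k) = pcomp (ppow \<gamma> k) \<gamma>"

definition tspan :: "('a \<rightharpoonup> 'a) \<Rightarrow> 'a set" where
  "tspan \<alpha> = dom \<alpha> \<union> ran \<alpha>"


subsection \<open>Basic partial transformations\<close>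

text \<open>The first argument is the enumeration of the points, the last one the partial map.\<close>

definition is_cycle :: "(nat \<Rightarrow> 'a) \<Rightarrow> nat \<Rightarrow> ('a \<rightharpoonup> 'a) \<Rightarrow> bool" where
  "is_cycle x k \<sigma> \<longleftrightarrow> k \<ge> 1 \<and> inj_on x {..<k} \<and> dom \<sigma> = x ` {..<k} \<and>
     (\<forall>i<k. \<sigma> (x i) = Some (x (Suc i mod k)))"

definition is_right_ray :: "(nat \<Rightarrow> 'a) \<Rightarrow> ('a \<rightharpoonup> 'a) \<Rightarrow> bool" where
  "is_right_ray x \<sigma> \<longleftrightarrow> inj x \<and> dom \<sigma> = range x \<and> (\<forall>i. \<sigma> (x i) = Some (x (Suc i)))"

definition is_double_ray :: "(int \<Rightarrow> 'a) \<Rightarrow> ('a \<rightharpoonup> 'a) \<Rightarrow> bool" where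
  "is_double_ray x \<sigma> \<longleftrightarrow> inj x \<and> dom \<sigma> = range x \<and> (\<forall>i. \<sigma> (x i) = Some (x (i + 1)))"

definition is_left_ray :: "(nat \<Rightarrow> 'a) \<Rightarrow> ('a \<rightharpoonup> 'a) \<Rightarrow> bool" where
  "is_left_ray x \<sigma> \<longleftrightarrow>
     inj x \<and> dom \<sigma> = range (\<lambda>i. x (Suc i)) \<and> (\<forall>i. \<sigma> (x (Suc i)) = Some (x i))"

definition is_chain :: "(nat \<Rightarrow> 'a) \<Rightarrow> nat \<Rightarrow> ('a \<rightharpoonup> 'a) \<Rightarrow> bool" where
  "is_chain x k \<sigma> \<longleftrightarrow> k \<ge> 1 \<and> inj_on x {..k} \<and> dom \<sigma> = x ` {..<k} \<and>
     (\<forall>i<k. \<sigma> (x i) = Some (x (Suc i)))"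

text \<open>Containment of partial maps is the library relation \<open>\<subseteq>\<^sub>m\<close>.\<close>

definition maximal_in :: "('a \<rightharpoonup> 'a) \<Rightarrow> ('a \<rightharpoonup> 'a) \<Rightarrow> bool" where
  "maximal_in \<mu> \<alpha> \<longleftrightarrow> \<mu> \<subseteq>\<^sub>m \<alpha> \<and>
     (\<forall>x \<in> tspan \<mu>. (x \<notin> dom \<mu> \<longrightarrow> x \<notin> dom \<alpha>) \<and> (x \<notin> ran \<mu> \<longrightarrow> x \<notin> ran \<alpha>))"

definition has_cycle_of_length :: "('a \<rightharpoonup> 'a) \<Rightarrow> nat \<Rightarrow> bool" where
  "has_cycle_of_length \<alpha> k \<longleftrightarrow> (\<exists>x \<sigma>. is_cycle x k \<sigma> \<and> \<sigma> \<subseteq>\<^sub>m \<alpha>)"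

definition has_cycle :: "('a \<rightharpoonup> 'a) \<Rightarrow> bool" where
  "has_cycle \<alpha> \<longleftrightarrow> (\<exists>k. has_cycle_of_length \<alpha> k)"

definition has_double_ray :: "('a \<rightharpoonup> 'a) \<Rightarrow> bool" where
  "has_double_ray \<alpha> \<longleftrightarrow> (\<exists>x \<sigma>. is_double_ray x \<sigma> \<and> \<sigma> \<subseteq>\<^sub>m \<alpha>)"

definition has_left_ray :: "('a \<rightharpoonup> 'a) \<Rightarrow> bool" where
  "has_left_ray \<alpha> \<longleftrightarrow> (\<exists>x \<sigma>. is_left_ray x \<sigma> \<and> \<sigma> \<subseteq>\<^sub>m \<alpha>)"

definition has_maximal_chain :: "('a \<rightharpoonup> 'a) \<Rightarrow> bool" where
  "has_maximal_chain \<alpha> \<longleftrightarrow> (\<exists>x k \<sigma>. is_chain x k \<sigma> \<and> maximal_in \<sigma> \<alpha>)"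

text \<open>\<open>x\<close> enumerates a right ray that is maximal in \<open>\<alpha>\<close>; a right ray determines its enumeration.\<close>

definition maximal_right_ray :: "(nat \<Rightarrow> 'a) \<Rightarrow> ('a \<rightharpoonup> 'a) \<Rightarrow> bool" where
  "maximal_right_ray x \<alpha> \<longleftrightarrow> (\<exists>\<sigma>. is_right_ray x \<sigma> \<and> maximal_in \<sigma> \<alpha>)"

definition cyc_set :: "('a \<rightharpoonup> 'a) \<Rightarrow> nat set" where
  "cyc_set \<alpha> = (let M = {k. has_cycle_of_length \<alpha> k} in {m \<in> M. \<forall>m' \<in> M. m' < m \<longrightarrow> \<not> m' dvd m})"


subsection \<open>Connected conn_components\<close>

definition connected_map :: "('a \<rightharpoonup> 'a) \<Rightarrow> bool" where
  "connected_map \<gamma> \<longleftrightarrow> \<gamma> \<noteq> Map.empty \<and>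
     (\<forall>x \<in> tspan \<gamma>. \<forall>y \<in> tspan \<gamma>. \<exists>k m. ppow \<gamma> k x = ppow \<gamma> m y \<and> ppow \<gamma> k x \<noteq> None)"

definition connected_decomposition :: "('a \<rightharpoonup> 'a) \<Rightarrow> ('a \<rightharpoonup> 'a) set \<Rightarrow> bool" where
  "connected_decomposition \<alpha> C \<longleftrightarrow>
     (\<forall>\<gamma> \<in> C. connected_map \<gamma> \<and> \<gamma> \<subseteq>\<^sub>m \<alpha>) \<and>
     pairwise (\<lambda>\<gamma> \<delta>. disjnt (tspan \<gamma>) (tspan \<delta>)) C \<and>
     (\<Union>\<gamma>\<in>C. Map.graph \<gamma>) = Map.graph \<alpha>"

lemma ppow_add: "ppow \<gamma> k x = Some u \<Longrightarrow> ppow \<gamma> (k + m) x = ppow \<gamma> m u"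
  by (induction m) (auto simp: pcomp_def map_comp_def)

lemma ppow_map_le: "\<gamma> \<subseteq>\<^sub>m \<alpha> \<Longrightarrow> ppow \<gamma> k x = Some u \<Longrightarrow> ppow \<alpha> k x = Some u"
proof (induction k arbitrary: u)
  case (Suc k)
  from Suc.prems(2) obtain v where "ppow \<gamma> k x = Some v" "\<gamma> v = Some u"
    by (auto simp: pcomp_def map_comp_Some_iff)
  then show ?case
    using Suc.IH Suc.prems(1) by (auto simp: pcomp_def map_le_def dom_def)
qed simp

lemma ex1_connected_decomposition: "\<exists>!C. connected_decomposition \<alpha> C"
proof -
  define R where "R x y \<longleftrightarrow> (\<exists>k m u. ppow \<alpha> k x = Some u \<and> ppow \<alpha> m y = Some u)" for x y
  define K where "K x = \<alpha> |` {y. R x y}" for x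
  have refl: "R x x" for x
    unfolding R_def by (metis ppow.simps(1))
  have sym: "R x y \<Longrightarrow> R y x" for x y
    unfolding R_def by metis
  have trans: "R x z" if "R x y" "R y z" for x y z
  proof -
    obtain k m u k' m' v where
      1: "ppow \<alpha> k x = Some u" "ppow \<alpha> m y = Some u" and
      2: "ppow \<alpha> k' y = Some v" "ppow \<alpha> m' z = Some v"
      using \<open>R x y\<close> \<open>R y z\<close> unfolding R_def by metis
    show ?thesis
    proof (cases "m \<le> k'")
      case True
      then have "ppow \<alpha> (k' - m) u = Some v"
        using ppow_add[OF 1(2), of "k' - m"] 2(1) by simp
      then have "ppow \<alpha> (k + (k' - m)) x = Some v"
        using ppow_add[OF 1(1)] by simp
      with 2(2) show ?thesis unfolding R_def by blast
    next
      case False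
      then have "ppow \<alpha> (m - k') v = Some u"
        using ppow_add[OF 2(1), of "m - k'"] 1(2) by simp
      then have "ppow \<alpha> (m' + (m - k')) z = Some u"
        using ppow_add[OF 2(2)] by simp
      with 1(1) show ?thesis unfolding R_def by blast
    qed
  qed
  have step: "R x y" if "ppow \<alpha> k x = Some y" for x y k
    unfolding R_def using that by (metis ppow.simps(1))
  have step1: "R x y" if "\<alpha> x = Some y" for x y
    using step[of "Suc 0" x y] that by (simp add: pcomp_def)
  have ppow_K: "ppow (K x) k y = Some u" if "R x y" "ppow \<alpha> k y = Some u" for x y k u
    using that(2)
  proof (induction k arbitrary: u)
    case (Suc k)
    then obtain v where v: "ppow \<alpha> k y = Some v" "\<alpha> v = Some u"
      by (auto simp: pcomp_def map_comp_Some_iff)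
    have "R x v" using trans[OF that(1) step[OF v(1)]] .
    then have "K x v = Some u" using v(2) by (simp add: K_def restrict_map_def)
    then show ?case using Suc.IH[OF v(1)] by (simp add: pcomp_def)
  qed simp
  have K_le: "K x \<subseteq>\<^sub>m \<alpha>" for x
    by (auto simp: K_def map_le_def restrict_map_def dom_def)
  have K_span: "R x y" if "y \<in> tspan (K x)" for x y
    using that unfolding tspan_def K_def
    by (auto simp: ran_def dom_def restrict_map_def split: if_splits intro: trans step1)
  have K_eq: "K x = K y" if "R x y" for x y
  proof -
    have "R x z = R y z" for z using that sym trans by blast
    then show ?thesis by (simp add: K_def)
  qed
  have K_conn: "connected_map (K x)" if "x \<in> dom \<alpha>" for x
    unfolding connected_map_def
  proof (intro conjI ballI)
    have "K x x = \<alpha> x" using refl by (simp add: K_def)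
    then show "K x \<noteq> Map.empty" using that by auto
  next
    fix y z assume "y \<in> tspan (K x)" "z \<in> tspan (K x)"
    then have *: "R x y" "R x z" using K_span by auto
    then have "R y z" using sym trans by blast
    then obtain k m u where "ppow \<alpha> k y = Some u" "ppow \<alpha> m z = Some u"
      unfolding R_def by blast
    then have "ppow (K x) k y = Some u" "ppow (K x) m z = Some u"
      using ppow_K * by auto
    then show "\<exists>k m. ppow (K x) k y = ppow (K x) m z \<and> ppow (K x) k y \<noteq> None"
      by (metis option.distinct(1))
  qed
  have dec: "connected_decomposition \<alpha> (K ` dom \<alpha>)"
    unfolding connected_decomposition_def
  proof (intro conjI)
    show "\<forall>\<gamma>\<in>K ` dom \<alpha>. connected_map \<gamma> \<and> \<gamma> \<subseteq>\<^sub>m \<alpha>" using K_conn K_le by blast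
    show "pairwise (\<lambda>\<gamma> \<delta>. disjnt (tspan \<gamma>) (tspan \<delta>)) (K ` dom \<alpha>)"
    proof (rule pairwiseI)
      fix \<gamma> \<delta> assume "\<gamma> \<in> K ` dom \<alpha>" "\<delta> \<in> K ` dom \<alpha>" "\<gamma> \<noteq> \<delta>"
      then show "disjnt (tspan \<gamma>) (tspan \<delta>)"
        unfolding disjnt_iff using K_span K_eq sym trans by (metis imageE)
    qed
    show "(\<Union>\<gamma>\<in>K ` dom \<alpha>. Map.graph \<gamma>) = Map.graph \<alpha>"
      using refl by (fastforce simp: Map.graph_def K_def restrict_map_def dom_def split: if_splits)
  qed
  have uniq: "D = K ` dom \<alpha>" if D: "connected_decomposition \<alpha> D" for D
  proof -
    have cov: "\<exists>\<delta>\<in>D. \<delta> y = Some z" if "\<alpha> y = Some z" for y z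
    proof -
      have "(y, z) \<in> (\<Union>\<gamma>\<in>D. Map.graph \<gamma>)"
        using D that by (auto simp: connected_decomposition_def Map.graph_def)
      then show ?thesis by (auto simp: Map.graph_def)
    qed
    have le: "\<gamma> \<subseteq>\<^sub>m \<alpha>" and conn: "connected_map \<gamma>" if "\<gamma> \<in> D" for \<gamma>
      using D that by (auto simp: connected_decomposition_def)
    have same: "\<gamma> = \<delta>" if "\<gamma> \<in> D" "\<delta> \<in> D" "x \<in> tspan \<gamma>" "x \<in> tspan \<delta>" for \<gamma> \<delta> x
      using D that unfolding connected_decomposition_def pairwise_def disjnt_iff by blast
    have in_span: "x \<in> tspan \<gamma> \<and> y \<in> tspan \<gamma>" if "\<gamma> x = Some y" for \<gamma> :: "'a \<rightharpoonup> 'a" and x y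
      using that by (auto simp: tspan_def ran_def)
    have span1: "x \<in> tspan \<gamma> \<longleftrightarrow> y \<in> tspan \<gamma>" if "\<gamma> \<in> D" "\<alpha> x = Some y" for \<gamma> x y
      using cov[OF that(2)] in_span same that(1) by metis
    have span_pow: "x \<in> tspan \<gamma> \<longleftrightarrow> u \<in> tspan \<gamma>" if "\<gamma> \<in> D" "ppow \<alpha> k x = Some u" for \<gamma> x k u
      using that(2)
    proof (induction k arbitrary: u)
      case (Suc k)
      then show ?case using span1[OF that(1)] by (auto simp: pcomp_def map_comp_Some_iff)
    qed simp
    have eq: "\<gamma> = K x" if \<gamma>: "\<gamma> \<in> D" and x: "x \<in> dom \<gamma>" for \<gamma> x
    proof (rule ext)
      fix y
      have xs: "x \<in> tspan \<gamma>" using x by (simp add: tspan_def)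
      show "\<gamma> y = K x y"
      proof (cases "y \<in> dom \<gamma>")
        case True
        then have "y \<in> tspan \<gamma>" by (simp add: tspan_def)
        with xs conn[OF \<gamma>] obtain k m where
          "ppow \<gamma> k x = ppow \<gamma> m y" "ppow \<gamma> k x \<noteq> None"
          unfolding connected_map_def by blast
        then obtain u where "ppow \<gamma> k x = Some u" "ppow \<gamma> m y = Some u" by auto
        then have "R x y" unfolding R_def using ppow_map_le[OF le[OF \<gamma>]] by blast
        then show ?thesis using True le[OF \<gamma>] by (simp add: K_def map_le_def)
      next
        case False
        have "K x y = None"
        proof (rule ccontr)
          assume "K x y \<noteq> None"
          then obtain z where "R x y" and z: "\<alpha> y = Some z"
            by (auto simp: K_def restrict_map_def split: if_splits)
          then have "y \<in> tspan \<gamma>" using xs span_pow[OF \<gamma>] unfolding R_def by blast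
          moreover obtain \<delta> where "\<delta> \<in> D" "\<delta> y = Some z" using cov[OF z] by blast
          ultimately show False using same[OF \<gamma>, of \<delta> y] in_span[of \<delta> y z] False by auto
        qed
        with False show ?thesis by auto
      qed
    qed
    show ?thesis
    proof (intro equalityI subsetI)
      fix \<gamma> assume \<gamma>: "\<gamma> \<in> D"
      then obtain x where x: "x \<in> dom \<gamma>" using conn unfolding connected_map_def by fastforce
      then have "x \<in> dom \<alpha>" using map_le_implies_dom_le[OF le[OF \<gamma>]] by blast
      then show "\<gamma> \<in> K ` dom \<alpha>" using eq[OF \<gamma> x] by blast
    next
      fix \<gamma> assume "\<gamma> \<in> K ` dom \<alpha>"
      then obtain x z where "\<gamma> = K x" "\<alpha> x = Some z" by auto
      then show "\<gamma> \<in> D" using cov eq by (metis domI)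
    qed
  qed
  from dec uniq show ?thesis by blast
qed

definition conn_components :: "('a \<rightharpoonup> 'a) \<Rightarrow> ('a \<rightharpoonup> 'a) set" where
  "conn_components \<alpha> = (THE C. connected_decomposition \<alpha> C)"

definition type_rro :: "('a \<rightharpoonup> 'a) \<Rightarrow> bool" where
  "type_rro \<gamma> \<longleftrightarrow> (\<exists>x. maximal_right_ray x \<gamma>) \<and>
     \<not> has_cycle \<gamma> \<and> \<not> has_double_ray \<gamma> \<and> \<not> has_left_ray \<gamma> \<and> \<not> has_maximal_chain \<gamma>"


section \<open>Ordinals\<close>

text \<open>
  Order types of the well-orders whose field is a subset of \<open>'a\<close>, that is, for infinite \<open>'a\<close>, the
  ordinals below the successor cardinal of the cardinality of \<open>'a\<close>.  Ranks of points of a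
  well-founded relation on an infinite \<open>'a\<close> are all among these; see \<open>ordinal_bounded\<close> below.
\<close>

quotient_type 'a ordinal = "'a rel" / partial: "\<lambda>r s. (r, s) \<in> ordIso"
proof (rule part_equivpI)
  show "\<exists>x::'a rel. (x, x) \<in> ordIso"
    using card_of_Well_order ordIso_reflexive by blast
  show "symp (\<lambda>r s::'a rel. (r, s) \<in> ordIso)"
    using ordIso_symmetric by (auto intro: sympI)
  show "transp (\<lambda>r s::'a rel. (r, s) \<in> ordIso)"
    using ordIso_transitive by (blast intro: transpI)
qed

lemma ordIso_Well_order: "(r, s) \<in> ordIso \<Longrightarrow> Well_order r"
  unfolding ordIso_iff_ordLeq using ordLeq_Well_order_simp by blast

instantiation ordinal :: (type) wellorder
begin

lift_definition less_eq_ordinal :: "'a ordinal \<Rightarrow> 'a ordinal \<Rightarrow> bool"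
  is "\<lambda>r s. (r, s) \<in> ordLeq"
  by (iprover intro: iffI dest: ordIso_ordLeq_trans ordLeq_ordIso_trans ordIso_symmetric)

lift_definition less_ordinal :: "'a ordinal \<Rightarrow> 'a ordinal \<Rightarrow> bool"
  is "\<lambda>r s. (r, s) \<in> ordLess"
  by (iprover intro: iffI dest: ordIso_ordLess_trans ordLess_ordIso_trans ordIso_symmetric)

instance
proof
  fix a b c :: "'a ordinal" and P :: "'a ordinal \<Rightarrow> bool"
  show "a < b \<longleftrightarrow> a \<le> b \<and> \<not> b \<le> a"
  proof transfer
    fix r s :: "'a rel"
    assume "(r, r) \<in> ordIso" "(s, s) \<in> ordIso"
    then have "Well_order r" "Well_order s" by (blast dest: ordIso_Well_order)+
    then show "(r, s) \<in> ordLess \<longleftrightarrow> (r, s) \<in> ordLeq \<and> (s, r) \<notin> ordLeq"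
      using not_ordLeq_iff_ordLess ordLess_imp_ordLeq by blast
  qed
  show "a \<le> a"
    by transfer (rule ordIso_imp_ordLeq)
  show "a \<le> b \<Longrightarrow> b \<le> c \<Longrightarrow> a \<le> c"
    by transfer (rule ordLeq_transitive)
  show "a \<le> b \<Longrightarrow> b \<le> a \<Longrightarrow> a = b"
    by transfer (simp add: ordIso_iff_ordLeq)
  show "a \<le> b \<or> b \<le> a"
    by transfer (iprover intro: ordLeq_total dest: ordIso_Well_order)
  show "P a" if step: "\<And>x. (\<And>y. y < x \<Longrightarrow> P y) \<Longrightarrow> P x"
  proof -
    have "wf {(x, y). x < (y :: 'a ordinal)}"
    proof (rule wf_subset[OF wf_inv_image[OF wf_ordLess, where f = rep_ordinal]])
      show "{(x, y). x < y} \<subseteq> inv_image ordLess (rep_ordinal :: 'a ordinal \<Rightarrow> 'a rel)"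
        by (auto simp: less_ordinal.rep_eq inv_image_def)
    qed
    then show "P a"
      by (induction rule: wf_induct_rule) (use step in blast)
  qed
qed

end

text \<open>The library type classes offer no unconditional supremum for ordinals; it is the least upper
  bound, and likewise the successor is the least larger ordinal.\<close>

definition osup :: "'a ordinal set \<Rightarrow> 'a ordinal" where
  "osup A = (LEAST b. \<forall>a\<in>A. a \<le> b)"

definition osucc :: "'a ordinal \<Rightarrow> 'a ordinal" where
  "osucc a = (LEAST b. a < b)"

lemma rep_ordinal_Well_order: "Well_order (rep_ordinal (a :: 'a ordinal))"
  using Quotient3_rep_reflp[OF Quotient3_ordinal, of a] by (rule ordIso_Well_order)

lemma card_le_ordinal_below:
  fixes a :: "'a ordinal"
  shows "(card_of {..<a}, card_of (UNIV :: 'a set)) \<in> ordLeq"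
proof -
  let ?r = "rep_ordinal a"
  let ?h = "\<lambda>x. abs_ordinal (Restr ?r (underS ?r x))"
  have "{..<a} \<subseteq> ?h ` UNIV"
  proof
    fix b assume "b \<in> {..<a}"
    then have "(rep_ordinal b, ?r) \<in> ordLess" by (simp add: less_ordinal.rep_eq)
    then have "\<exists>x \<in> Field ?r. (rep_ordinal b, Restr ?r (underS ?r x)) \<in> ordIso"
      by (simp only: ordLess_iff_ordIso_Restr[OF rep_ordinal_Well_order rep_ordinal_Well_order])
    then obtain x where x: "(rep_ordinal b, Restr ?r (underS ?r x)) \<in> ordIso" by blast
    have "b = ?h x"
      using Quotient3_rel_abs[OF Quotient3_ordinal, OF x]
        Quotient3_abs_rep[OF Quotient3_ordinal, of b] by simp
    then show "b \<in> ?h ` UNIV" by blast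
  qed
  then show ?thesis
    using card_of_image card_of_mono1 ordLeq_transitive by blast
qed

lemma ordinal_bounded:
  fixes A :: "'a ordinal set"
  assumes inf: "infinite (UNIV :: 'a set)"
    and A: "(card_of A, card_of (UNIV :: 'a set)) \<in> ordLeq"
  shows "\<exists>b. \<forall>a\<in>A. a < b"
proof (rule ccontr)
  assume "\<nexists>b. \<forall>a\<in>A. a < b"
  then have cover: "(UNIV :: 'a ordinal set) = (\<Union>a\<in>A. insert a {..<a})"
    by (auto simp: not_less) (metis le_less)
  have "(card_of (insert a {..<a}), card_of (UNIV :: 'a set)) \<in> ordLeq" for a :: "'a ordinal"
  proof -
    have "(card_of ({a} \<union> {..<a}), card_of (UNIV :: 'a set)) \<in> ordLeq"
      using inf card_le_ordinal_below
      by (intro card_of_Un_ordLeq_infinite_Field)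
        (auto simp: Field_card_of card_of_card_order_on card_of_singl_ordLeq)
    then show ?thesis by simp
  qed
  then have "(card_of (UNIV :: 'a ordinal set), card_of (UNIV :: 'a set)) \<in> ordLeq"
    unfolding cover by (intro card_of_UNION_ordLeq_infinite[OF inf A] ballI)
  then obtain f :: "'a ordinal \<Rightarrow> 'a" where f: "inj f"
    using card_of_ordLeq[of "UNIV :: 'a ordinal set" "UNIV :: 'a set"] by auto
  define s where "s = {(x, y). x \<le> (y :: 'a ordinal)}"
  define r where "r = dir_image s f"
  have "Field s = UNIV" by (auto simp: s_def Field_def)
  have "s - Id = {(x, y). x < y}" by (auto simp: s_def)
  then have "wf (s - Id)" using wf by metis
  then have "Well_order s"
    using \<open>Field s = UNIV\<close>
    by (auto simp: well_order_on_def linear_order_on_def partial_order_on_def preorder_on_def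
        refl_on_def trans_def antisym_def total_on_def s_def)
  then have r: "Well_order r"
    unfolding r_def using f \<open>Field s = UNIV\<close> by (intro Well_order_dir_image) (auto simp: inj_on_def)
  have r_iff: "(f x, f y) \<in> r \<longleftrightarrow> x \<le> y" for x y
    using f by (auto simp: r_def dir_image_def s_def inj_on_def)
  interpret r: wo_rel r using r by (simp add: wo_rel_def)
  define h where "h x = abs_ordinal (Restr r (underS r (f x)))" for x
  have Field_f: "f x \<in> Field r" for x using r_iff[of x x] by (auto simp: Field_def)
  have abs_less: "abs_ordinal p < (abs_ordinal q :: 'a ordinal)" if "(p, q) \<in> ordLess" for p q
  proof -
    have "Well_order p \<and> Well_order q"
      using ordLess_imp_ordLeq[OF that] by (rule ordLeq_Well_order_simp)
    then show ?thesis
      using that less_ordinal.abs_eq[of p q] ordIso_reflexive[of p] ordIso_reflexive[of q] by blast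
  qed
  have mono: "h x < h y" if "x < y" for x y
  proof -
    have "underS r (f x) \<subset> underS r (f y)"
    proof -
      have "f x \<in> underS r (f y)" "f x \<notin> underS r (f x)"
        using that r_iff f by (auto simp: underS_def inj_on_def)
      moreover have "underS r (f x) \<subseteq> underS r (f y)"
      proof
        fix z assume z: "z \<in> underS r (f x)"
        have xy: "(f x, f y) \<in> r" using that r_iff by simp
        then have "(z, f y) \<in> r" using z r.TRANS by (auto simp: underS_def elim: transE)
        moreover have "z \<noteq> f y" using z xy r.ANTISYM by (auto simp: underS_def dest: antisymD)
        ultimately show "z \<in> underS r (f y)" by (simp add: underS_def)
      qed
      ultimately show ?thesis by blast
    qed
    then have "(Restr r (underS r (f x)), Restr r (underS r (f y))) \<in> ordLess"
      using ofilter_subset_ordLess[OF r r.underS_ofilter r.underS_ofilter] by blast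
    then show ?thesis unfolding h_def by (rule abs_less)
  qed
  have below: "h x < abs_ordinal r" for x
  proof -
    have "underS r (f x) \<subset> Field r"
      using Field_f[of x] by (auto simp: underS_def Field_def)
    then have "(Restr r (underS r (f x)), r) \<in> ordLess"
      using ofilter_ordLess[OF r r.underS_ofilter] by blast
    then show ?thesis unfolding h_def by (rule abs_less)
  qed
  have "x \<le> h x" for x
  proof (induction x rule: less_induct)
    case (less x)
    show ?case
    proof (rule ccontr)
      assume "\<not> x \<le> h x"
      then have "h x < x" by simp
      with less mono show False using leD by blast
    qed
  qed
  with below show False using leD by blast
qed

lemma osup_osucc_image:
  assumes "infinite (UNIV :: 'a set)"
  fixes g :: "'a \<Rightarrow> 'a ordinal"
  shows "a \<in> A \<Longrightarrow> g a < osup {osucc (g a) | a. a \<in> A}"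
    and "(\<And>a. a \<in> A \<Longrightarrow> g a < b) \<Longrightarrow> osup {osucc (g a) | a. a \<in> A} \<le> b"
proof -
  have le: "osucc (g a) \<le> b" if "g a < b" for a b
    using that by (auto simp: osucc_def Least_le)
  have "(card_of (g ` A), card_of (UNIV :: 'a set)) \<in> ordLeq"
    using card_of_image card_of_mono1[of A UNIV] ordLeq_transitive by blast
  then obtain c where c: "\<forall>a\<in>g ` A. a < c" using ordinal_bounded[OF assms] by blast
  have ub: "\<forall>a\<in>{osucc (g a) | a. a \<in> A}. a \<le> osup {osucc (g a) | a. a \<in> A}"
    unfolding osup_def by (rule LeastI[of _ c]) (use c le in auto)
  show "g a < osup {osucc (g a) | a. a \<in> A}" if "a \<in> A"
  proof -
    have "g a < osucc (g a)" unfolding osucc_def by (rule LeastI[of _ c]) (use c that in auto)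
    also have "\<dots> \<le> osup {osucc (g a) | a. a \<in> A}" using ub that by blast
    finally show ?thesis .
  qed
  show "osup {osucc (g a) | a. a \<in> A} \<le> b" if "\<And>a. a \<in> A \<Longrightarrow> g a < b"
    unfolding osup_def by (rule Least_le) (use that le in auto)
qed


section \<open>Rank and domination\<close>

definition pred_rel :: "('a \<rightharpoonup> 'a) \<Rightarrow> 'a rel" where
  "pred_rel \<gamma> = {(y, x). \<gamma> y = Some x}"

text \<open>Only meaningful when \<open>pred_rel \<gamma>\<close> is well-founded, as it is for \<open>\<gamma>\<close> of type \<open>rro\<close>; such a
  \<open>\<gamma>\<close> contains a ray, so \<open>'a\<close> is infinite and the suprema exist by \<open>osup_osucc_image\<close>.\<close>

definition pt_rank :: "('a \<rightharpoonup> 'a) \<Rightarrow> 'a \<Rightarrow> 'a ordinal" where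
  "pt_rank \<gamma> = wfrec (pred_rel \<gamma>) (\<lambda>\<rho> x. osup {osucc (\<rho> y) | y. \<gamma> y = Some x})"

lemma pt_rank_unfold:
  assumes "wf (pred_rel \<gamma>)"
  shows "pt_rank \<gamma> x = osup {osucc (pt_rank \<gamma> y) | y. \<gamma> y = Some x}"
proof -
  have "{osucc (cut (pt_rank \<gamma>) (pred_rel \<gamma>) x y) | y. \<gamma> y = Some x} =
        {osucc (pt_rank \<gamma> y) | y. \<gamma> y = Some x}"
    by (auto simp: cut_def pred_rel_def)
  then show ?thesis
    by (subst def_wfrec[OF pt_rank_def[THEN eq_reflection] assms]) simp
qed

definition seq_dominates :: "(nat \<Rightarrow> 'b::ord) \<Rightarrow> (nat \<Rightarrow> 'b) \<Rightarrow> bool" where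
  "seq_dominates b a \<longleftrightarrow> (\<exists>k. \<forall>n. b (k + n) \<ge> a n)"

definition exactly_one :: "bool \<Rightarrow> bool \<Rightarrow> bool \<Rightarrow> bool" where
  "exactly_one P Q R \<longleftrightarrow> (P \<and> \<not> Q \<and> \<not> R) \<or> (\<not> P \<and> Q \<and> \<not> R) \<or> (\<not> P \<and> \<not> Q \<and> R)"

end

theory Submission
  imports Defs
begin

text \<open>
  In \<open>T(X)\<close> the set \<open>\<P>\<^sup>1(\<alpha>)\<close> is all of \<open>T(X)\<close>, so \<open>\<alpha> \<sim>\<^sub>c \<beta>\<close> says that there are homomorphisms of
  unary algebras from \<open>(X, \<alpha>)\<close> to \<open>(X, \<beta>)\<close> and back.  Homomorphisms can be built one connected component
  at a time, and they carry cycles of length \<open>k\<close> to cycles of length dividing \<open>k\<close>, bi-infinite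
  orbits to bi-infinite orbits, and never lower the rank of a point.  Conversely, an acyclic
  component maps to any bi-infinite orbit, a component with a cycle of length \<open>k\<close> to any cycle whose length divides
  \<open>k\<close>.  If there are no bi-infinite orbits, the predecessor relation is well-founded, and a
  domination of rank sequences along two rays extends to a homomorphism of the components.
\<close>

section \<open>Conjugacy as a pair of homomorphisms\<close>

text \<open>The function \<open>\<phi>\<close> is total, but its values off
  \<open>tspan \<alpha>\<close> are arbitrary; so one notion serves both the full maps on
  \<open>X\<close> and their components.\<close>

definition map_hom :: "('a \<rightharpoonup> 'a) \<Rightarrow> ('b \<rightharpoonup> 'b) \<Rightarrow> ('a \<Rightarrow> 'b) \<Rightarrow> bool" where
  "map_hom \<alpha> \<beta> \<phi> \<longleftrightarrow> (\<forall>x y. \<alpha> x = Some y \<longrightarrow> \<beta> (\<phi> x) = Some (\<phi> y))"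

lemma full_trans_iff: "\<alpha> \<in> full_trans X \<longleftrightarrow> dom \<alpha> = X \<and> ran \<alpha> \<subseteq> X"
  by (auto simp: full_trans_def partial_trans_def)

lemma full_trans_ex_image:
  assumes "\<alpha> \<in> full_trans X" and "x \<in> X"
  shows "\<exists>y \<in> X. \<alpha> x = Some y"
proof -
  obtain y where "\<alpha> x = Some y" using assms by (auto simp: full_trans_iff)
  moreover then have "y \<in> X" using assms(1) by (auto simp: full_trans_iff intro: ranI)
  ultimately show ?thesis by blast
qed

lemma pcomp_Some_iff: "pcomp \<alpha> \<beta> x = Some z \<longleftrightarrow> (\<exists>y. \<alpha> x = Some y \<and> \<beta> y = Some z)"
  by (auto simp: pcomp_def map_comp_Some_iff)

lemma full_trans_identity: "sg_identity (full_trans X) pcomp (Some |` X)"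
proof -
  have "pcomp (Some |` X) \<gamma> = \<gamma>" "pcomp \<gamma> (Some |` X) = \<gamma>" if "\<gamma> \<in> full_trans X" for \<gamma>
  proof -
    have "pcomp (Some |` X) \<gamma> x = \<gamma> x \<and> pcomp \<gamma> (Some |` X) x = \<gamma> x" for x
      using that
      by (auto simp: full_trans_iff pcomp_def map_comp_def restrict_map_def ran_def
          split: option.splits)
    then show "pcomp (Some |` X) \<gamma> = \<gamma>" "pcomp \<gamma> (Some |` X) = \<gamma>" by auto
  qed
  moreover have "Some |` X \<in> full_trans X"
    by (auto simp: full_trans_iff ran_def restrict_map_def split: if_splits)
  ultimately show ?thesis by (simp add: sg_identity_def)
qed

lemma one_ext_full_trans: "one_ext (full_trans X) pcomp = Some (Some |` X)"
proof -
  have "(THE e. sg_identity (full_trans X) pcomp e) = Some |` X"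
  proof (rule the_equality)
    fix e assume e: "sg_identity (full_trans X) pcomp e"
    have "pcomp e (Some |` X) = e"
      using e full_trans_identity[of X] unfolding sg_identity_def by blast
    moreover have "pcomp e (Some |` X) = Some |` X"
      using e full_trans_identity[of X] unfolding sg_identity_def by blast
    ultimately show "e = Some |` X" by simp
  qed (rule full_trans_identity)
  then show ?thesis using full_trans_identity[of X] by (auto simp: one_ext_def)
qed

text \<open>Constant maps are right zeros, so a zero equals every constant map. Two points of
  \<open>X\<close> would then give the same constant map, hence \<open>X\<close> has at most one
  point.\<close>

lemma full_trans_zero_singleton:
  assumes z: "sg_zero (full_trans X) pcomp z"
    and "\<alpha> \<in> full_trans X" and "\<beta> \<in> full_trans X"
  shows "\<alpha> = \<beta>"
proof -
  have const: "(\<lambda>x. Some a) |` X = z" if "a \<in> X" for a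
  proof -
    let ?c = "(\<lambda>x. Some a) |` X"
    have "?c \<in> full_trans X"
      using that by (auto simp: full_trans_iff ran_def restrict_map_def split: if_splits)
    then have "pcomp z ?c = z" and "z \<in> full_trans X" using z by (auto simp: sg_zero_def)
    moreover have "pcomp z ?c = ?c"
    proof
      fix x show "pcomp z ?c x = ?c x"
        using \<open>z \<in> full_trans X\<close>
        by (auto simp: full_trans_iff pcomp_def map_comp_def restrict_map_def ran_def
          split: option.splits)
    qed
    ultimately show ?thesis by simp
  qed
  have single: "a = b" if "a \<in> X" "b \<in> X" for a b
    using const[OF that(1)] const[OF that(2)] that
    by (metis option.inject restrict_in)
  show ?thesis
  proof
    fix x show "\<alpha> x = \<beta> x"
    proof (cases "x \<in> X")
      case True
      then obtain a b where "\<alpha> x = Some a" "\<beta> x = Some b" "a \<in> X" "b \<in> X"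
        using full_trans_ex_image[OF assms(2)] full_trans_ex_image[OF assms(3)] by blast
      with single show ?thesis by simp
    next
      case False
      then have "\<alpha> x = None" "\<beta> x = None"
        using assms(2,3) by (auto simp: full_trans_iff)
      then show ?thesis by simp
    qed
  qed
qed

text \<open>Without a zero, \<open>PP\<close> is the whole semigroup by definition. With a zero the
  semigroup consists of the identity alone, and \<open>PP1\<close> contains the identity in any
  case.\<close>

lemma PP1_full_trans: "PP1 (full_trans X) pcomp \<alpha> = Some ` full_trans X"
proof (cases "\<exists>z. sg_zero (full_trans X) pcomp z")
  case False
  then show ?thesis
    using full_trans_identity[of X] by (auto simp: PP1_def PP_def one_ext_full_trans sg_identity_def)
next
  case True
  then obtain z where z: "sg_zero (full_trans X) pcomp z" by blast
  have e: "Some |` X \<in> full_trans X" using full_trans_identity[of X] by (simp add: sg_identity_def)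
  have "full_trans X = {Some |` X}" using full_trans_zero_singleton[OF z _ e] e by blast
  moreover have "(THE z. sg_zero (full_trans X) pcomp z) = z"
  proof (rule the_equality)
    fix w assume w: "sg_zero (full_trans X) pcomp w"
    have "pcomp w z = w" using w z unfolding sg_zero_def by blast
    moreover have "pcomp w z = z" using w z unfolding sg_zero_def by blast
    ultimately show "w = z" by simp
  qed (rule z)
  moreover have "z \<in> full_trans X" using z by (simp add: sg_zero_def)
  ultimately have "PP (full_trans X) pcomp \<alpha> \<subseteq> {Some |` X}"
    using True by (auto simp: PP_def Let_def)
  then show ?thesis
    using \<open>full_trans X = {Some |` X}\<close> unfolding PP1_def one_ext_full_trans by auto
qed

lemma ex_intertwiner_iff_hom:
  assumes "\<alpha> \<in> full_trans X" and "\<beta> \<in> full_trans X"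
  shows "(\<exists>g \<in> full_trans X. pcomp \<alpha> g = pcomp g \<beta>) \<longleftrightarrow> (\<exists>\<phi>. map_hom \<alpha> \<beta> \<phi>)"
proof
  assume "\<exists>g \<in> full_trans X. pcomp \<alpha> g = pcomp g \<beta>"
  then obtain g where g: "dom g = X" "pcomp \<alpha> g = pcomp g \<beta>" by (auto simp: full_trans_iff)
  have "\<beta> (the (g x)) = Some (the (g y))" if xy: "\<alpha> x = Some y" for x y
  proof -
    have "x \<in> X" "y \<in> X" using xy assms(1) by (auto simp: full_trans_iff ran_def)
    then obtain u v where uv: "g x = Some u" "g y = Some v" using g(1) by blast
    then have "pcomp \<alpha> g x = Some v" using xy by (simp add: pcomp_Some_iff)
    then have "\<beta> u = Some v" using g(2) uv by (simp add: pcomp_Some_iff)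
    with uv show ?thesis by simp
  qed
  then have "map_hom \<alpha> \<beta> (\<lambda>x. the (g x))" by (simp add: map_hom_def)
  then show "\<exists>\<phi>. map_hom \<alpha> \<beta> \<phi>" by blast
next
  assume "\<exists>\<phi>. map_hom \<alpha> \<beta> \<phi>"
  then obtain \<phi> where \<phi>: "\<And>x y. \<alpha> x = Some y \<Longrightarrow> \<beta> (\<phi> x) = Some (\<phi> y)"
    by (auto simp: map_hom_def)
  let ?g = "(\<lambda>x. Some (\<phi> x)) |` X"
  have \<alpha>: "\<exists>y\<in>X. \<alpha> x = Some y" if "x \<in> X" for x
    using that full_trans_ex_image[OF assms(1)] by blast
  \<comment> \<open>Each point of \<open>X\<close> has an image under \<open>\<alpha>\<close>, so
    the homomorphism property puts \<open>\<phi> x\<close> into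
    \<open>dom \<beta> = X\<close>.\<close>
  have "\<phi> x \<in> X" if "x \<in> X" for x
    using \<alpha>[OF that] \<phi> assms(2) by (force simp: full_trans_iff)
  then have "?g \<in> full_trans X"
    by (auto simp: full_trans_iff ran_def restrict_map_def split: if_splits)
  moreover have "pcomp \<alpha> ?g = pcomp ?g \<beta>"
  proof
    fix x show "pcomp \<alpha> ?g x = pcomp ?g \<beta> x"
    proof (cases "x \<in> X")
      case True
      with \<alpha> \<phi> show ?thesis by (fastforce simp: pcomp_def map_comp_def restrict_map_def)
    next
      case False
      then have "\<alpha> x = None" using assms(1) by (auto simp: full_trans_iff)
      with False show ?thesis by (simp add: pcomp_def map_comp_def restrict_map_def)
    qed
  qed
  ultimately show "\<exists>g \<in> full_trans X. pcomp \<alpha> g = pcomp g \<beta>" by blast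
qed

lemma conj_c_full_trans_iff:
  assumes "\<alpha> \<in> full_trans X" and "\<beta> \<in> full_trans X"
  shows "conj_c (full_trans X) pcomp \<alpha> \<beta> \<longleftrightarrow> (\<exists>\<phi>. map_hom \<alpha> \<beta> \<phi>) \<and> (\<exists>\<psi>. map_hom \<beta> \<alpha> \<psi>)"
  unfolding ex_intertwiner_iff_hom[OF assms, symmetric]
    ex_intertwiner_iff_hom[OF assms(2,1), symmetric]
  by (auto simp: conj_c_def PP1_full_trans)


section \<open>Cycles and bi-infinite orbits\<close>

lemma ppow_Suc_front:
  "ppow \<alpha> (Suc n) x = Some z \<longleftrightarrow> (\<exists>y. \<alpha> x = Some y \<and> ppow \<alpha> n y = Some z)"
  by (induction n arbitrary: z) (auto simp: pcomp_Some_iff)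

lemma ppow_Suc_Some:
  "ppow \<alpha> (Suc n) x = Some z \<longleftrightarrow> (\<exists>y. ppow \<alpha> n x = Some y \<and> \<alpha> y = Some z)"
  by (auto simp: pcomp_Some_iff)

lemma map_hom_ppow:
  assumes "map_hom \<alpha> \<beta> \<phi>" and "ppow \<alpha> n x = Some y"
  shows "ppow \<beta> n (\<phi> x) = Some (\<phi> y)"
  using assms(2)
proof (induction n arbitrary: y)
  case (Suc n)
  then show ?case using assms(1) by (auto simp: pcomp_Some_iff map_hom_def)
qed simp

text \<open>The condition \<open>ran \<alpha> \<subseteq> dom \<alpha>\<close> is the form in which
  fullness is used for orbits: a forward orbit never stops. Unlike membership in
  \<open>full_trans X\<close>, it passes to components.\<close>

lemma ppow_closed:
  assumes "ran \<alpha> \<subseteq> dom \<alpha>" and "x \<in> dom \<alpha>"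
  shows "\<exists>y \<in> dom \<alpha>. ppow \<alpha> n x = Some y"
proof (induction n)
  case (Suc n)
  then obtain y z where "ppow \<alpha> n x = Some y" "\<alpha> y = Some z" by blast
  moreover then have "z \<in> dom \<alpha>" using assms(1) by (auto simp: ran_def)
  ultimately show ?case by (simp add: pcomp_def)
qed (use assms in auto)

lemma ppow_orbit:
  assumes "\<And>n. \<alpha> (x n) = Some (x (Suc n))"
  shows "ppow \<alpha> n (x k) = Some (x (k + n))"
  by (induction n) (auto simp: pcomp_Some_iff assms)

text \<open>Points may repeat, so that a double ray and the endless winding round a cycle are both
  covered, and homomorphic images are again of this kind.\<close>

definition biorbit :: "('a \<rightharpoonup> 'a) \<Rightarrow> (int \<Rightarrow> 'a) \<Rightarrow> bool" where
  "biorbit \<alpha> c \<longleftrightarrow> (\<forall>i. \<alpha> (c i) = Some (c (i + 1)))"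

lemma biorbit_ppow:
  assumes "biorbit \<alpha> c"
  shows "ppow \<alpha> n (c i) = Some (c (i + int n))"
  using assms by (induction n) (auto simp: pcomp_Some_iff biorbit_def algebra_simps)

lemma map_hom_biorbit: "map_hom \<alpha> \<beta> \<phi> \<Longrightarrow> biorbit \<alpha> c \<Longrightarrow> biorbit \<beta> (\<phi> \<circ> c)"
  by (simp add: map_hom_def biorbit_def)

lemma cycle_ppow:
  assumes "is_cycle x k \<sigma>" and "\<sigma> \<subseteq>\<^sub>m \<alpha>"
  shows "ppow \<alpha> n (x 0) = Some (x (n mod k))"
proof (induction n)
  case (Suc n)
  have "n mod k < k" using assms(1) by (simp add: is_cycle_def)
  then have "\<sigma> (x (n mod k)) = Some (x (Suc n mod k))"
    using assms(1) by (simp add: is_cycle_def mod_Suc_eq)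
  then have "\<alpha> (x (n mod k)) = Some (x (Suc n mod k))"
    using assms(2) by (metis domI map_le_def)
  with Suc show ?case by (simp add: pcomp_Some_iff)
qed (use assms in \<open>auto simp: is_cycle_def\<close>)

text \<open>The last conjunct records that the orbit of \<open>x\<close> meets itself only at times
  congruent modulo \<open>k\<close>. This is what makes levels well defined when the component of
  \<open>x\<close> is wound round a cycle whose length divides \<open>k\<close>.\<close>

lemma has_cycle_of_length_periodic:
  assumes "has_cycle_of_length \<alpha> k"
  shows "k \<ge> 1 \<and> (\<exists>x. x \<in> dom \<alpha> \<and> ppow \<alpha> k x = Some x \<and>
    (\<forall>i j u. ppow \<alpha> i x = Some u \<longrightarrow> ppow \<alpha> j x = Some u \<longrightarrow> int k dvd int i - int j))"
proof -
  from assms obtain x \<sigma> where x: "is_cycle x k \<sigma>" "\<sigma> \<subseteq>\<^sub>m \<alpha>"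
    by (auto simp: has_cycle_of_length_def)
  have k: "k \<ge> 1" using x(1) by (simp add: is_cycle_def)
  have "int k dvd int i - int j" if "ppow \<alpha> i (x 0) = Some u" "ppow \<alpha> j (x 0) = Some u" for i j u
  proof -
    have "x (i mod k) = x (j mod k)" using that cycle_ppow[OF x] by simp
    then have "i mod k = j mod k"
      using x(1) k by (auto simp: is_cycle_def dest!: inj_onD)
    then have "int i mod int k = int j mod int k" by (metis zmod_int)
    then show ?thesis by (simp add: mod_eq_dvd_iff)
  qed
  moreover have "ppow \<alpha> k (x 0) = Some (x 0)" using cycle_ppow[OF x, of k] by simp
  moreover have "x 0 \<in> dom \<alpha>"
    using cycle_ppow[OF x, of 1] by (auto simp: pcomp_Some_iff)
  ultimately show ?thesis using k by blast
qed

text \<open>Reducing the index modulo \<open>k\<close> extends the orbit of \<open>x\<close> to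
  negative times. Here \<open>k\<close> is any return time, not necessarily the least.\<close>

lemma periodic_biorbit:
  assumes "ppow \<alpha> k x = Some x" and "k \<ge> 1"
  shows "\<exists>c. biorbit \<alpha> c \<and> c 0 = x \<and> (\<forall>i j. int k dvd i - j \<longrightarrow> c i = c j)"
proof -
  define c where "c i = the (ppow \<alpha> (nat (i mod int k)) x)" for i
  \<comment> \<open>Since \<open>\<alpha>\<close> may be partial, definedness is propagated
    downwards from the return at time \<open>k\<close>.\<close>
  have def: "\<exists>y. ppow \<alpha> i x = Some y" if "i \<le> k" for i
    using that
  proof (induction "k - i" arbitrary: i)
    case 0
    then show ?case using assms(1) by auto
  next
    case (Suc d)
    then have "\<exists>y. ppow \<alpha> (Suc i) x = Some y" by (intro Suc.hyps) auto
    then show ?case by (auto simp: pcomp_Some_iff)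
  qed
  have "\<alpha> (c i) = Some (c (i + 1))" for i
  proof -
    define m where "m = nat (i mod int k)"
    have m: "int m = i mod int k" "m < k"
      using assms(2) by (auto simp: m_def nat_less_iff)
    then obtain y z where yz: "ppow \<alpha> m x = Some y" "ppow \<alpha> (Suc m) x = Some z" "\<alpha> y = Some z"
      using def[of "Suc m"] by (auto simp: pcomp_Some_iff)
    have "(i + 1) mod int k = (int m + 1) mod int k" using m(1) by (simp add: mod_add_left_eq)
    \<comment> \<open>At the last residue the index wraps to 0, which is harmless because
      \<open>ppow \<alpha> k x\<close> is again \<open>x\<close>.\<close>
    then have "(i + 1) mod int k = (if Suc m = k then 0 else int (Suc m))"
      using m(2) by (auto simp: algebra_simps)
    then have "c (i + 1) = z" using yz(2) assms(1) by (auto simp: c_def nat_add_distrib)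
    moreover have "c i = y" using yz(1) by (simp add: c_def m_def)
    ultimately show ?thesis using yz(3) by simp
  qed
  moreover have "c i = c j" if "int k dvd i - j" for i j
    using that by (simp add: c_def mod_eq_dvd_iff[symmetric])
  moreover have "c 0 = x" by (simp add: c_def)
  ultimately show ?thesis unfolding biorbit_def by blast
qed

lemma biorbit_shift:
  assumes "biorbit \<alpha> c" and "c i = c j"
  shows "c (i + int n) = c (j + int n)"
  using biorbit_ppow[OF assms(1), of n i] biorbit_ppow[OF assms(1), of n j] assms(2) by simp

lemma map_le_restrict: "\<alpha> |` A \<subseteq>\<^sub>m \<alpha>"
  by (auto simp: map_le_def restrict_map_def split: if_splits)

text \<open>The cycle is the orbit of \<open>x\<close> up to its least return time \<open>k\<close>.
  It divides \<open>n\<close> because \<open>n mod k\<close> is a return time below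
  \<open>k\<close>, hence 0.\<close>

lemma periodic_has_cycle:
  assumes "ppow \<alpha> n x = Some x" and "n \<ge> 1"
  shows "\<exists>k. has_cycle_of_length \<alpha> k \<and> k dvd n"
proof -
  define k where "k = (LEAST k. k \<ge> 1 \<and> ppow \<alpha> k x = Some x)"
  have k: "k \<ge> 1" "ppow \<alpha> k x = Some x"
    using LeastI[of "\<lambda>k. k \<ge> 1 \<and> ppow \<alpha> k x = Some x" n] assms by (auto simp: k_def)
  have least: "k \<le> j" if "j \<ge> 1" "ppow \<alpha> j x = Some x" for j
    unfolding k_def using that by (intro Least_le) auto
  obtain c where c: "biorbit \<alpha> c" "c 0 = x" "\<And>i j. int k dvd i - j \<Longrightarrow> c i = c j"
    using periodic_biorbit[OF k(2,1)] by blast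
  have return: "ppow \<alpha> j x = Some x \<longleftrightarrow> c (int j) = x" for j
    using biorbit_ppow[OF c(1), of j 0] c(2) by simp
  \<comment> \<open>If the points at times \<open>i < j < k\<close> agreed, running both for
    \<open>k - i\<close> further steps would give a return to \<open>x\<close> at time
    \<open>j - i\<close>, before the least one.\<close>
  have ne: "c (int i) \<noteq> c (int j)" if "i < j" "j < k" for i j
  proof
    assume "c (int i) = c (int j)"
    from biorbit_shift[OF c(1) this, of "k - i"] have "c (int k) = c (int (j - i) + int k)"
      using that by (simp add: of_nat_diff algebra_simps)
    moreover have "c (int k) = c 0" "c (int (j - i) + int k) = c (int (j - i))"
      by (auto intro: c(3))
    ultimately have "ppow \<alpha> (j - i) x = Some x" using return c(2) by simp
    then have "k \<le> j - i" using that by (intro least) auto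
    with that show False by simp
  qed
  have "inj_on (\<lambda>i. c (int i)) {..<k}"
    by (rule linorder_inj_onI) (use ne in auto)
  moreover have "\<alpha> (c (int i)) = Some (c (int (Suc i mod k)))" for i
  proof -
    have "\<alpha> (c (int i)) = Some (c (int i + 1))" using c(1) by (simp add: biorbit_def)
    moreover have "c (int i + 1) = c (int (Suc i mod k))"
      by (rule c(3)) (simp add: zmod_int mod_eq_dvd_iff[symmetric] add.commute)
    ultimately show ?thesis by simp
  qed
  ultimately have "is_cycle (\<lambda>i. c (int i)) k (\<alpha> |` ((\<lambda>i. c (int i)) ` {..<k}))"
    using k(1) by (auto simp: is_cycle_def restrict_map_def dom_def)
  then have "has_cycle_of_length \<alpha> k"
    unfolding has_cycle_of_length_def by (blast intro: map_le_restrict)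
  moreover have "k dvd n"
  proof -
    have "c (int n) = c (int (n mod k))"
      by (rule c(3)) (simp add: zmod_int mod_eq_dvd_iff[symmetric])
    then have "ppow \<alpha> (n mod k) x = Some x" using assms(1) return by simp
    moreover have "n mod k < k" using k(1) by simp
    ultimately have "\<not> n mod k \<ge> 1" using least by fastforce
    then show ?thesis by (simp add: dvd_eq_mod_eq_0)
  qed
  ultimately show ?thesis by blast
qed

lemma has_cycle_of_length_biorbit:
  assumes "has_cycle_of_length \<alpha> k"
  shows "\<exists>c. biorbit \<alpha> c \<and> (\<forall>i j. int k dvd i - j \<longrightarrow> c i = c j)"
proof -
  obtain x where "ppow \<alpha> k x = Some x" "k \<ge> 1"
    using has_cycle_of_length_periodic[OF assms] by blast
  from periodic_biorbit[OF this] show ?thesis by blast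
qed

text \<open>The image of a point of the cycle returns after \<open>k\<close> steps but possibly
  earlier, so a divisor of \<open>k\<close> is all that can be asserted.\<close>

lemma map_hom_cycle:
  assumes "map_hom \<alpha> \<beta> \<phi>" and "has_cycle_of_length \<alpha> k"
  shows "\<exists>k'. has_cycle_of_length \<beta> k' \<and> k' dvd k"
proof -
  obtain x where "k \<ge> 1" "ppow \<alpha> k x = Some x"
    using has_cycle_of_length_periodic[OF assms(2)] by blast
  then have "ppow \<beta> k (\<phi> x) = Some (\<phi> x)" using map_hom_ppow[OF assms(1)] by blast
  then show ?thesis using \<open>k \<ge> 1\<close> by (rule periodic_has_cycle)
qed

lemma map_hom_has_cycle: "map_hom \<alpha> \<beta> \<phi> \<Longrightarrow> has_cycle \<alpha> \<Longrightarrow> has_cycle \<beta>"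
  unfolding has_cycle_def by (auto dest: map_hom_cycle)

lemma acyclic_ppow_inj:
  assumes "\<not> has_cycle \<alpha>" and "ppow \<alpha> i x = Some u" and "ppow \<alpha> j x = Some u"
  shows "i = j"
proof -
  have False if "i < j" "ppow \<alpha> i x = Some u" "ppow \<alpha> j x = Some u" for i j
  proof -
    have "ppow \<alpha> (j - i) u = Some u" using ppow_add[OF that(2), of "j - i"] that by simp
    moreover have "j - i \<ge> 1" using that(1) by simp
    ultimately show False
      using periodic_has_cycle[of \<alpha> "j - i" u] assms(1) unfolding has_cycle_def by blast
  qed
  with assms(2,3) show ?thesis by (metis nat_neq_iff)
qed

lemma biorbit_has_double_ray:
  assumes "\<not> has_cycle \<alpha>" and "biorbit \<alpha> c"
  shows "has_double_ray \<alpha>"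
proof -
  have "c i \<noteq> c j" if "i < j" for i j
  proof
    assume "c i = c j"
    then have "ppow \<alpha> (nat (j - i)) (c i) = Some (c i)"
      using biorbit_ppow[OF assms(2), of "nat (j - i)" i] that by simp
    then have "nat (j - i) = 0" by (rule acyclic_ppow_inj[OF assms(1)]) simp
    with that show False by simp
  qed
  then have "inj c" by (auto intro: linorder_injI)
  then have "is_double_ray c (\<alpha> |` range c)"
    using assms(2) by (auto simp: is_double_ray_def biorbit_def restrict_map_def dom_def)
  then show ?thesis unfolding has_double_ray_def using map_le_restrict by blast
qed

lemma has_double_ray_biorbit:
  assumes "has_double_ray \<alpha>"
  shows "\<exists>c. biorbit \<alpha> c"
proof -
  from assms obtain c \<sigma> where c: "is_double_ray c \<sigma>" "\<sigma> \<subseteq>\<^sub>m \<alpha>"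
    by (auto simp: has_double_ray_def)
  then have "biorbit \<alpha> c" unfolding biorbit_def is_double_ray_def by (metis domI map_le_def)
  then show ?thesis by blast
qed

lemma ex_biorbit_iff: "(\<exists>c. biorbit \<alpha> c) \<longleftrightarrow> has_cycle \<alpha> \<or> has_double_ray \<alpha>"
  by (auto simp: has_cycle_def dest: has_cycle_of_length_biorbit has_double_ray_biorbit
      intro: biorbit_has_double_ray)

text \<open>A bi-infinite orbit read backwards is an infinite descent in
  \<open>pred_rel \<alpha>\<close>. Conversely, a descent is continued forwards by the orbit of its
  first point, which never stops since \<open>ran \<alpha> \<subseteq> dom \<alpha>\<close>.\<close>

lemma ex_biorbit_iff_not_wf:
  assumes "ran \<alpha> \<subseteq> dom \<alpha>"
  shows "(\<exists>c. biorbit \<alpha> c) \<longleftrightarrow> \<not> wf (pred_rel \<alpha>)"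
proof
  assume "\<exists>c. biorbit \<alpha> c"
  then obtain c where c: "biorbit \<alpha> c" ..
  have "\<alpha> (c (- int (Suc i))) = Some (c (- int i))" for i
    using c unfolding biorbit_def by (metis (no_types) add.commute add.left_neutral
      minus_add_distrib of_nat_Suc uminus_add_conv_diff diff_add_cancel)
  then have "\<forall>i. (c (- int (Suc i)), c (- int i)) \<in> pred_rel \<alpha>" by (simp add: pred_rel_def)
  then have "\<exists>s. \<forall>i. (s (Suc i), s i) \<in> pred_rel \<alpha>" by (intro exI[of _ "\<lambda>i. c (- int i)"])
  then show "\<not> wf (pred_rel \<alpha>)" by (simp add: wf_iff_no_infinite_down_chain)
next
  assume "\<not> wf (pred_rel \<alpha>)"
  then obtain s where s: "\<And>i. \<alpha> (s (Suc i)) = Some (s i)"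
    by (auto simp: wf_iff_no_infinite_down_chain pred_rel_def)
  define c where "c i = (if i \<ge> 0 then the (ppow \<alpha> (nat i) (s 0)) else s (nat (- i)))" for i
  have s0: "s 0 \<in> dom \<alpha>" using s[of 0] assms by (auto simp: ran_def)
  have "\<alpha> (c i) = Some (c (i + 1))" for i
  proof (cases "i \<ge> 0")
    case True
    then have eq: "nat (i + 1) = Suc (nat i)" by simp
    obtain y z where "ppow \<alpha> (nat i) (s 0) = Some y" "\<alpha> y = Some z"
      using ppow_closed[OF assms s0, of "nat i"] by blast
    then show ?thesis
      using True unfolding c_def eq by (simp add: pcomp_def)
  next
    case False
    \<comment> \<open>With this \<open>n\<close>, \<open>c i\<close> is \<open>s (Suc n)\<close> and
      \<open>c (i + 1)\<close> is \<open>s n\<close>; for \<open>i = -1\<close> this holds because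
      both branches of \<open>c\<close> give \<open>s 0\<close> at index 0.\<close>
    define n where "n = nat (- i - 1)"
    have "i = - 1 - int n" using False by (simp add: n_def)
    then show ?thesis using s[of n] by (auto simp: c_def nat_add_distrib Suc_nat_eq_nat_zadd1)
  qed
  then show "\<exists>c. biorbit \<alpha> c" by (auto simp: biorbit_def)
qed

section \<open>Cycle lengths up to divisibility\<close>

lemma cyc_set_below:
  assumes "has_cycle_of_length \<alpha> k"
  shows "\<exists>m \<in> cyc_set \<alpha>. m dvd k"
  using assms
proof (induction k rule: less_induct)
  case (less k)
  show ?case
  proof (cases "k \<in> cyc_set \<alpha>")
    case False
    with less.prems obtain m where "has_cycle_of_length \<alpha> m" "m < k" "m dvd k"
      by (auto simp: cyc_set_def)
    with less.IH show ?thesis by (meson dvd_trans)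
  qed (blast intro: dvd_refl)
qed

text \<open>\<open>cyc_set\<close> collects the lengths minimal under divisibility, and every length
  lies above a minimal one. The right-hand side is the form in which homomorphisms act on cycle
  lengths.\<close>

lemma cyc_set_eq_iff:
  fixes \<alpha> \<beta> :: "'a \<rightharpoonup> 'a"
  shows "cyc_set \<alpha> = cyc_set \<beta> \<longleftrightarrow>
    (\<forall>k. has_cycle_of_length \<alpha> k \<longrightarrow> (\<exists>k'. has_cycle_of_length \<beta> k' \<and> k' dvd k)) \<and>
    (\<forall>k. has_cycle_of_length \<beta> k \<longrightarrow> (\<exists>k'. has_cycle_of_length \<alpha> k' \<and> k' dvd k))"
    (is "_ \<longleftrightarrow> ?below \<alpha> \<beta> \<and> ?below \<beta> \<alpha>")
proof
  have len: "has_cycle_of_length \<gamma> m" if "m \<in> cyc_set \<gamma>" for \<gamma> :: "'a \<rightharpoonup> 'a" and m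
    using that by (simp add: cyc_set_def)
  show "?below \<alpha> \<beta> \<and> ?below \<beta> \<alpha>" if "cyc_set \<alpha> = cyc_set \<beta>"
    using that cyc_set_below len by metis
next
  have sub: "cyc_set \<gamma> \<subseteq> cyc_set \<delta>" if below: "?below \<gamma> \<delta>" "?below \<delta> \<gamma>"
    for \<gamma> \<delta> :: "'a \<rightharpoonup> 'a"
  proof
    fix m assume m: "m \<in> cyc_set \<gamma>"
    then have "has_cycle_of_length \<gamma> m" "m \<ge> 1"
      using has_cycle_of_length_periodic by (auto simp: cyc_set_def)
    have min: "m' = m" if "has_cycle_of_length \<gamma> m'" "m' dvd m" for m'
      using m that dvd_imp_le[OF that(2)] \<open>m \<ge> 1\<close> by (fastforce simp: cyc_set_def)
    \<comment> \<open>Going from \<open>\<gamma>\<close> to \<open>\<delta>\<close> and back yields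
      \<open>m' dvd k\<close>, \<open>k dvd l\<close> and \<open>l dvd m\<close>; minimality of
      \<open>m\<close> gives \<open>m' = m\<close>, whence \<open>k = m\<close>.\<close>
    obtain l where l: "has_cycle_of_length \<delta> l" "l dvd m"
      using below(1) \<open>has_cycle_of_length \<gamma> m\<close> by blast
    obtain k where "k \<in> cyc_set \<delta>" "k dvd l" using cyc_set_below[OF l(1)] by blast
    with l(2) have k: "k \<in> cyc_set \<delta>" "k dvd m" by (auto intro: dvd_trans)
    then obtain m' where "has_cycle_of_length \<gamma> m'" "m' dvd k"
      using below(2) by (auto simp: cyc_set_def)
    moreover then have "m' = m" using min k(2) by (blast intro: dvd_trans)
    ultimately have "m dvd k" by simp
    with k show "m \<in> cyc_set \<delta>" using dvd_antisym[of k m] by simp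
  qed
  show "cyc_set \<alpha> = cyc_set \<beta>" if "?below \<alpha> \<beta> \<and> ?below \<beta> \<alpha>"
    using sub[of \<alpha> \<beta>] sub[of \<beta> \<alpha>] that by blast
qed


section \<open>Connected components\<close>

lemma conn_components_decomposition: "connected_decomposition \<alpha> (conn_components \<alpha>)"
  unfolding conn_components_def by (rule theI'[OF ex1_connected_decomposition])

lemma conn_componentD:
  assumes "\<gamma> \<in> conn_components \<alpha>"
  shows "connected_map \<gamma>" and "\<gamma> \<subseteq>\<^sub>m \<alpha>"
  using conn_components_decomposition[of \<alpha>] assms by (auto simp: connected_decomposition_def)

lemma conn_component_le: "\<gamma> \<in> conn_components \<alpha> \<Longrightarrow> \<gamma> x = Some y \<Longrightarrow> \<alpha> x = Some y"
  using conn_componentD(2) by (metis domI map_le_def)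

lemma conn_component_unique:
  assumes "\<gamma> \<in> conn_components \<alpha>" "\<delta> \<in> conn_components \<alpha>" "x \<in> tspan \<gamma>" "x \<in> tspan \<delta>"
  shows "\<gamma> = \<delta>"
  using conn_components_decomposition[of \<alpha>] assms
  unfolding connected_decomposition_def pairwise_def disjnt_iff by blast

lemma tspanI: "\<gamma> x = Some y \<Longrightarrow> x \<in> tspan \<gamma>" "\<gamma> x = Some y \<Longrightarrow> y \<in> tspan \<gamma>"
  by (auto simp: tspan_def ran_def)

lemma ex_conn_component:
  assumes "\<alpha> x = Some y"
  shows "\<exists>\<gamma> \<in> conn_components \<alpha>. \<gamma> x = Some y"
proof -
  have "(x, y) \<in> (\<Union>\<gamma> \<in> conn_components \<alpha>. Map.graph \<gamma>)"
    using conn_components_decomposition[of \<alpha>] assms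
    by (auto simp: connected_decomposition_def Map.graph_def)
  then show ?thesis by (auto simp: Map.graph_def)
qed

text \<open>The arrow lies in some component, which by disjointness of spans must be
  \<open>\<gamma>\<close>. In particular a component contains all predecessors of its points, as the
  comparison of ranks requires.\<close>

lemma conn_component_step:
  assumes "\<gamma> \<in> conn_components \<alpha>" and "\<alpha> x = Some y" and "x \<in> tspan \<gamma> \<or> y \<in> tspan \<gamma>"
  shows "\<gamma> x = Some y"
  using ex_conn_component[of \<alpha> x y, OF assms(2)] conn_component_unique[OF assms(1)] assms(3) tspanI
  by metis

lemma conn_component_ran_dom:
  assumes "ran \<alpha> \<subseteq> dom \<alpha>" and "\<gamma> \<in> conn_components \<alpha>"
  shows "ran \<gamma> \<subseteq> dom \<gamma>"
proof
  fix y assume y: "y \<in> ran \<gamma>"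
  then have "y \<in> ran \<alpha>" using conn_component_le[OF assms(2)] by (auto simp: ran_def)
  then obtain z where "\<alpha> y = Some z" using assms(1) by blast
  then have "\<gamma> y = Some z" using conn_component_step[OF assms(2)] y by (simp add: tspan_def)
  then show "y \<in> dom \<gamma>" by blast
qed

lemma connected_mapE:
  assumes "connected_map \<gamma>" and "x \<in> tspan \<gamma>" and "y \<in> tspan \<gamma>"
  obtains k m u where "ppow \<gamma> k x = Some u" and "ppow \<gamma> m y = Some u"
  using assms unfolding connected_map_def by (metis not_None_eq)

lemma biorbit_conn_component:
  assumes "biorbit \<alpha> c"
  shows "\<exists>\<gamma> \<in> conn_components \<alpha>. biorbit \<gamma> c"
proof -
  have c: "\<alpha> (c i) = Some (c (i + 1))" for i using assms by (simp add: biorbit_def)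
  obtain \<gamma> where \<gamma>: "\<gamma> \<in> conn_components \<alpha>" "\<gamma> (c 0) = Some (c (0 + 1))"
    using ex_conn_component[of \<alpha> "c 0"] c[of 0] by blast
  have "c i \<in> tspan \<gamma>" for i
  proof (induction i rule: int_induct[of _ 0])
    case base
    then show ?case using \<gamma>(2) tspanI by metis
  next
    case (step1 i)
    then show ?case using conn_component_step[OF \<gamma>(1) c] tspanI by metis
  next
    case (step2 i)
    then show ?case using conn_component_step[OF \<gamma>(1) c, of "i - 1"] tspanI by force
  qed
  then have "biorbit \<gamma> c"
    unfolding biorbit_def using conn_component_step[OF \<gamma>(1) c] by blast
  with \<gamma>(1) show ?thesis by blast
qed

section \<open>Building homomorphisms component by component\<close>

lemma map_hom_glue:
  assumes "\<And>\<gamma>. \<gamma> \<in> conn_components \<alpha> \<Longrightarrow> \<exists>\<phi>. map_hom \<gamma> \<beta> \<phi>"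
  shows "\<exists>\<phi>. map_hom \<alpha> \<beta> \<phi>"
proof -
  obtain \<Phi> where \<Phi>: "\<And>\<gamma>. \<gamma> \<in> conn_components \<alpha> \<Longrightarrow> map_hom \<gamma> \<beta> (\<Phi> \<gamma>)"
    using assms by metis
  \<comment> \<open>Both ends of an arrow lie in the span of one component, so a single local map
    handles it. Off all spans the description is arbitrary, which \<open>map_hom\<close>
    permits.\<close>
  define comp where "comp x = (THE \<gamma>. \<gamma> \<in> conn_components \<alpha> \<and> x \<in> tspan \<gamma>)" for x
  have comp: "comp x = \<gamma>" if "\<gamma> \<in> conn_components \<alpha>" "x \<in> tspan \<gamma>" for x \<gamma>
    unfolding comp_def using that conn_component_unique by (intro the_equality) auto
  have "\<beta> (\<Phi> (comp x) x) = Some (\<Phi> (comp y) y)" if xy: "\<alpha> x = Some y" for x y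
  proof -
    obtain \<gamma> where "\<gamma> \<in> conn_components \<alpha>" "\<gamma> x = Some y"
      using ex_conn_component[of \<alpha> x y, OF xy] by blast
    moreover then have "comp x = \<gamma>" "comp y = \<gamma>" using comp tspanI by metis+
    ultimately show ?thesis using \<Phi> by (simp add: map_hom_def)
  qed
  then have "map_hom \<alpha> \<beta> (\<lambda>x. \<Phi> (comp x) x)" by (simp add: map_hom_def)
  then show ?thesis by blast
qed

text \<open>A point \<open>y\<close> with \<open>x\<^sub>0 \<gamma>\<^sup>k = y \<gamma>\<^sup>m\<close> has level \<open>k - m\<close> relative to \<open>x\<^sub>0\<close>, up to the period of
  \<open>x\<^sub>0\<close>; the homomorphism sends it to the point of the orbit with that index.\<close>

lemma map_hom_into_biorbit:
  assumes conn: "connected_map \<gamma>" and x0: "x0 \<in> tspan \<gamma>" and c: "biorbit \<beta> c"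
    and per: "\<And>i j u t. ppow \<gamma> i x0 = Some u \<Longrightarrow> ppow \<gamma> j x0 = Some u \<Longrightarrow>
      c (int i + t) = c (int j + t)"
  shows "\<exists>\<phi>. map_hom \<gamma> \<beta> \<phi>"
proof -
  define lev where
    "lev y d \<longleftrightarrow> (\<exists>k m u. ppow \<gamma> k x0 = Some u \<and> ppow \<gamma> m y = Some u \<and> d = int k - int m)" for y d
  \<comment> \<open>Continuing from \<open>u\<close> for \<open>m' - m\<close> steps leads to
    \<open>u'\<close>, so \<open>x0\<close> reaches \<open>u'\<close> both at time
    \<open>k + (m' - m)\<close> and at time \<open>k'\<close>; \<open>per\<close> then identifies
    the two indices.\<close>
  have same: "c (int k - int m) = c (int k' - int m')"
    if "ppow \<gamma> k x0 = Some u" "ppow \<gamma> m y = Some u" "ppow \<gamma> k' x0 = Some u'" "ppow \<gamma> m' y = Some u'"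
      "m \<le> m'" for y k m u k' m' u'
  proof -
    have "ppow \<gamma> (m' - m) u = Some u'" using ppow_add[OF that(2), of "m' - m"] that by simp
    then have "ppow \<gamma> (k + (m' - m)) x0 = Some u'" using ppow_add[OF that(1)] by simp
    from per[OF this that(3), of "- int m'"] show ?thesis
      using that(5) by (simp add: of_nat_diff algebra_simps)
  qed
  have lev_c: "c d = c e" if d: "lev y d" and e: "lev y e" for y d e
  proof -
    obtain k m u where 1: "ppow \<gamma> k x0 = Some u" "ppow \<gamma> m y = Some u" "d = int k - int m"
      using d unfolding lev_def by blast
    obtain k' m' u' where 2: "ppow \<gamma> k' x0 = Some u'" "ppow \<gamma> m' y = Some u'" "e = int k' - int m'"
      using e unfolding lev_def by blast
    show ?thesis
    proof (cases "m \<le> m'")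
      case True
      then show ?thesis using same[OF 1(1,2) 2(1,2)] 1(3) 2(3) by simp
    next
      case False
      then show ?thesis using same[OF 2(1,2) 1(1,2)] 1(3) 2(3) by simp
    qed
  qed
  \<comment> \<open>A point has many levels if the component has a cycle, but \<open>c\<close> takes
    one value on all of them, so any choice serves.\<close>
  define \<phi> where "\<phi> y = c (SOME d. lev y d)" for y
  have \<phi>: "\<phi> y = c d" if "lev y d" for y d
    unfolding \<phi>_def using someI[of "lev y", OF that] that by (rule lev_c)
  have "\<beta> (\<phi> y) = Some (\<phi> z)" if yz: "\<gamma> y = Some z" for y z
  proof -
    obtain k m u where u: "ppow \<gamma> k x0 = Some u" "ppow \<gamma> m z = Some u"
      using connected_mapE[OF conn x0 tspanI(2)[of \<gamma> y]] yz by blast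
    then have "ppow \<gamma> (Suc m) y = Some u" using yz unfolding ppow_Suc_front by blast
    with u have "lev y (int k - int (Suc m))" "lev z (int k - int m)" unfolding lev_def by blast+
    then show ?thesis
      using \<phi> c[unfolded biorbit_def, rule_format, of "int k - int (Suc m)"] by simp
  qed
  then have "map_hom \<gamma> \<beta> \<phi>" by (simp add: map_hom_def)
  then show ?thesis by blast
qed

text \<open>Each component chooses its own target: the given orbit \<open>c\<close> receives the
  acyclic ones, while one with a cycle of length \<open>k\<close> goes to a cycle of
  \<open>\<beta>\<close> of length dividing \<open>k\<close>.\<close>

lemma map_hom_exists_if_biorbit:
  assumes c: "biorbit \<beta> c"
    and cyc: "\<And>k. has_cycle_of_length \<alpha> k \<Longrightarrow> \<exists>k'. has_cycle_of_length \<beta> k' \<and> k' dvd k"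
  shows "\<exists>\<phi>. map_hom \<alpha> \<beta> \<phi>"
proof (rule map_hom_glue)
  fix \<gamma> assume \<gamma>: "\<gamma> \<in> conn_components \<alpha>"
  note conn = conn_componentD(1)[OF \<gamma>]
  show "\<exists>\<phi>. map_hom \<gamma> \<beta> \<phi>"
  proof (cases "has_cycle \<gamma>")
    case True
    then obtain k where k: "has_cycle_of_length \<gamma> k" by (auto simp: has_cycle_def)
    then obtain x0 where x0: "x0 \<in> dom \<gamma>"
      "\<And>i j u. ppow \<gamma> i x0 = Some u \<Longrightarrow> ppow \<gamma> j x0 = Some u \<Longrightarrow> int k dvd int i - int j"
      using has_cycle_of_length_periodic[OF k] by blast
    have "has_cycle_of_length \<alpha> k"
      using k conn_componentD(2)[OF \<gamma>] map_le_trans unfolding has_cycle_of_length_def by blast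
    then obtain k' where k': "has_cycle_of_length \<beta> k'" "k' dvd k" using cyc by blast
    then obtain d where d: "biorbit \<beta> d" "\<And>i j. int k' dvd i - j \<Longrightarrow> d i = d j"
      using has_cycle_of_length_biorbit by blast
    \<comment> \<open>The base point \<open>x0\<close> meets its own orbit only at times differing
      by multiples of \<open>k\<close>, hence of \<open>k'\<close>, and \<open>d\<close> repeats
      with period \<open>k'\<close>.\<close>
    show ?thesis
    proof (rule map_hom_into_biorbit[OF conn _ d(1)])
      show "x0 \<in> tspan \<gamma>" using x0(1) by (simp add: tspan_def)
      fix i j u t assume "ppow \<gamma> i x0 = Some u" "ppow \<gamma> j x0 = Some u"
      then have "int k dvd int i - int j" by (rule x0(2))
      then have "int k' dvd int i - int j" using k'(2) by (meson dvd_trans int_dvd_int_iff)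
      then show "d (int i + t) = d (int j + t)" by (intro d(2)) simp
    qed
  next
    case False
    obtain x0 where "x0 \<in> tspan \<gamma>"
      using conn unfolding connected_map_def tspan_def by fastforce
    then show ?thesis
      using acyclic_ppow_inj[OF False] by (intro map_hom_into_biorbit[OF conn _ c]) auto
  qed
qed


section \<open>Type rro and rank\<close>

lemma wf_pred_rel_acyclic: "wf (pred_rel \<gamma>) \<Longrightarrow> ran \<gamma> \<subseteq> dom \<gamma> \<Longrightarrow> \<not> has_cycle \<gamma>"
  using ex_biorbit_iff[of \<gamma>] ex_biorbit_iff_not_wf[of \<gamma>] by blast

lemma maximal_right_ray_step:
  "maximal_right_ray \<xi> \<gamma> \<Longrightarrow> \<gamma> (\<xi> n) = Some (\<xi> (Suc n))"
  unfolding maximal_right_ray_def is_right_ray_def maximal_in_def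
  by (metis domI map_le_def)

lemma maximal_right_ray_inj: "maximal_right_ray \<xi> \<gamma> \<Longrightarrow> inj \<xi>"
  by (auto simp: maximal_right_ray_def is_right_ray_def)

text \<open>Going back from \<open>y\<close> along predecessors ends, by well-foundedness, at a
  point \<open>z\<close> outside \<open>ran \<gamma>\<close>. The forward orbit of \<open>z\<close>
  is injective because there are no cycles, and it is maximal because \<open>z\<close> has no
  predecessor.\<close>

lemma maximal_right_ray_through:
  assumes wf: "wf (pred_rel \<gamma>)" and closed: "ran \<gamma> \<subseteq> dom \<gamma>" and y: "y \<in> dom \<gamma>"
  shows "\<exists>\<xi> k. maximal_right_ray \<xi> \<gamma> \<and> \<xi> k = y"
proof -
  have "\<exists>z k. z \<in> dom \<gamma> \<and> z \<notin> ran \<gamma> \<and> ppow \<gamma> k z = Some y"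
    using wf y
  proof (induction y rule: wf_induct_rule)
    case (less y)
    show ?case
    proof (cases "y \<in> ran \<gamma>")
      case True
      then obtain w where w: "\<gamma> w = Some y" by (auto simp: ran_def)
      then obtain z k where "z \<in> dom \<gamma>" "z \<notin> ran \<gamma>" "ppow \<gamma> k z = Some w"
        using less.IH[of w] by (auto simp: pred_rel_def)
      with w show ?thesis using ppow_Suc_Some by metis
    next
      case False
      with less.prems show ?thesis by (intro exI[of _ y] exI[of _ 0]) auto
    qed
  qed
  then obtain z k where z: "z \<in> dom \<gamma>" "z \<notin> ran \<gamma>" "ppow \<gamma> k z = Some y" by blast
  define \<xi> where "\<xi> n = the (ppow \<gamma> n z)" for n
  have \<xi>: "ppow \<gamma> n z = Some (\<xi> n)" for n
    using ppow_closed[OF closed z(1), of n] by (auto simp: \<xi>_def)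
  then have step: "\<gamma> (\<xi> n) = Some (\<xi> (Suc n))" for n
    using \<xi>[of "Suc n"] by (auto simp: pcomp_Some_iff)
  have "inj \<xi>"
    using acyclic_ppow_inj[OF wf_pred_rel_acyclic[OF wf closed]] \<xi> by (metis injI)
  then have "is_right_ray \<xi> (\<gamma> |` range \<xi>)"
    using step by (auto simp: is_right_ray_def restrict_map_def dom_def)
  moreover have "maximal_in (\<gamma> |` range \<xi>) \<gamma>"
  proof -
    have "\<xi> (Suc n) \<in> ran (\<gamma> |` range \<xi>)" for n
      using step[of n] by (auto simp: ran_def restrict_map_def)
    \<comment> \<open>The only point of the ray that is not an image within the ray is its origin
      \<open>\<xi> 0\<close>, which is \<open>z\<close>.\<close>
    then have "x \<notin> ran \<gamma>" if "x \<in> range \<xi>" "x \<notin> ran (\<gamma> |` range \<xi>)" for x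
      using that z(2) \<xi>[of 0] by (metis imageE not0_implies_Suc option.inject ppow.simps(1))
    moreover have "dom (\<gamma> |` range \<xi>) = range \<xi>" using step by (auto simp: dom_def restrict_map_def)
    moreover then have "tspan (\<gamma> |` range \<xi>) = range \<xi>"
      using step by (auto simp: tspan_def ran_def restrict_map_def split: if_splits)
    ultimately show ?thesis by (simp add: maximal_in_def map_le_restrict)
  qed
  ultimately have "maximal_right_ray \<xi> \<gamma>" unfolding maximal_right_ray_def by blast
  moreover have "\<xi> k = y" using \<xi>[of k] z(3) by simp
  ultimately show ?thesis by blast
qed

lemma conn_component_wf:
  assumes "wf (pred_rel \<alpha>)" and "\<gamma> \<in> conn_components \<alpha>"
  shows "wf (pred_rel \<gamma>)"
  by (rule wf_subset[OF assms(1)]) (auto simp: pred_rel_def conn_component_le[OF assms(2)])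

text \<open>Cycles, double rays and left rays each yield an infinite descent. The last point of a
  maximal chain would lie in \<open>ran \<gamma>\<close> but not in
  \<open>dom \<gamma>\<close>.\<close>

lemma type_rro_if_wf:
  assumes wf: "wf (pred_rel \<gamma>)" and closed: "ran \<gamma> \<subseteq> dom \<gamma>" and ne: "\<gamma> \<noteq> Map.empty"
  shows "type_rro \<gamma>"
proof -
  obtain y where "y \<in> dom \<gamma>" using ne by fastforce
  then have "\<exists>\<xi>. maximal_right_ray \<xi> \<gamma>" using maximal_right_ray_through[OF wf closed] by blast
  moreover have "\<not> has_cycle \<gamma>" "\<not> has_double_ray \<gamma>"
    using wf ex_biorbit_iff[of \<gamma>] ex_biorbit_iff_not_wf[OF closed] by auto
  moreover have "\<not> has_left_ray \<gamma>"
  proof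
    assume "has_left_ray \<gamma>"
    then obtain x \<sigma> where "is_left_ray x \<sigma>" "\<sigma> \<subseteq>\<^sub>m \<gamma>" by (auto simp: has_left_ray_def)
    then have "\<gamma> (x (Suc i)) = Some (x i)" for i
      unfolding is_left_ray_def by (metis domI map_le_def)
    then have "\<forall>i. (x (Suc i), x i) \<in> pred_rel \<gamma>" by (simp add: pred_rel_def)
    with wf show False unfolding wf_iff_no_infinite_down_chain by blast
  qed
  moreover have "\<not> has_maximal_chain \<gamma>"
  proof
    assume "has_maximal_chain \<gamma>"
    then obtain x k \<sigma> where x: "is_chain x k \<sigma>" "maximal_in \<sigma> \<gamma>"
      by (auto simp: has_maximal_chain_def)
    have "\<sigma> (x (k - 1)) = Some (x k)" using x(1) by (auto simp: is_chain_def)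
    then have "x k \<in> tspan \<sigma>" by (rule tspanI(2))
    moreover have "\<gamma> (x (k - 1)) = Some (x k)"
      using x(2) \<open>\<sigma> (x (k - 1)) = Some (x k)\<close> unfolding maximal_in_def map_le_def by (metis domI)
    ultimately have ran: "x k \<in> tspan \<sigma>" "x k \<in> ran \<gamma>" by (auto intro: ranI)
    have "x k \<notin> dom \<sigma>"
      using x(1) by (auto simp: is_chain_def dest: inj_onD)
    then have "x k \<notin> dom \<gamma>" using x(2) ran(1) by (auto simp: maximal_in_def)
    with closed ran(2) show False by blast
  qed
  ultimately show ?thesis by (simp add: type_rro_def)
qed

text \<open>A bi-infinite orbit of \<open>\<alpha>\<close> lies inside one component and would give
  it a cycle or a double ray. Conversely, well-foundedness and closure under images pass to the
  components.\<close>

lemma all_components_rro_iff: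
  assumes "ran \<alpha> \<subseteq> dom \<alpha>"
  shows "(\<forall>\<gamma> \<in> conn_components \<alpha>. type_rro \<gamma>) \<longleftrightarrow> wf (pred_rel \<alpha>)"
proof
  assume rro: "\<forall>\<gamma> \<in> conn_components \<alpha>. type_rro \<gamma>"
  then have "\<not> biorbit \<gamma> c" if "\<gamma> \<in> conn_components \<alpha>" for \<gamma> c
    using that ex_biorbit_iff[of \<gamma>] by (auto simp: type_rro_def)
  then show "wf (pred_rel \<alpha>)"
    using ex_biorbit_iff_not_wf[OF assms] biorbit_conn_component by blast
next
  assume wf: "wf (pred_rel \<alpha>)"
  show "\<forall>\<gamma> \<in> conn_components \<alpha>. type_rro \<gamma>"
  proof
    fix \<gamma> assume \<gamma>: "\<gamma> \<in> conn_components \<alpha>"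
    show "type_rro \<gamma>"
    proof (rule type_rro_if_wf)
      show "wf (pred_rel \<gamma>)" using wf \<gamma> by (rule conn_component_wf)
      show "ran \<gamma> \<subseteq> dom \<gamma>" using assms \<gamma> by (rule conn_component_ran_dom)
      show "\<gamma> \<noteq> Map.empty" using conn_componentD(1)[OF \<gamma>] by (simp add: connected_map_def)
    qed
  qed
qed

section \<open>Ranks and homomorphisms\<close>

lemma pt_rank_component:
  assumes wf: "wf (pred_rel \<alpha>)" and \<gamma>: "\<gamma> \<in> conn_components \<alpha>" and "x \<in> tspan \<gamma>"
  shows "pt_rank \<gamma> x = pt_rank \<alpha> x"
  using wf assms(3)
proof (induction x rule: wf_induct_rule)
  case (less x)
  \<comment> \<open>A point of the span has the same predecessors in \<open>\<gamma>\<close> as in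
    \<open>\<alpha>\<close>, so the recursion equations of the two ranks coincide.\<close>
  have iff: "\<gamma> y = Some x \<longleftrightarrow> \<alpha> y = Some x" for y
    using conn_component_step[OF \<gamma>] conn_component_le[OF \<gamma>] less.prems by blast
  have eq: "pt_rank \<gamma> y = pt_rank \<alpha> y" if "\<alpha> y = Some x" for y
    using that tspanI(1)[of \<gamma> y x] iff by (intro less.IH) (simp_all add: pred_rel_def)
  have "{osucc (pt_rank \<gamma> y) | y. \<gamma> y = Some x} = {osucc (pt_rank \<alpha> y) | y. \<alpha> y = Some x}"
    by (intro Collect_cong ex_cong1) (auto simp: iff eq)
  then show ?case
    by (simp add: pt_rank_unfold[OF wf, of x] pt_rank_unfold[OF conn_component_wf[OF wf \<gamma>], of x])
qed

text \<open>\<open>osup_osucc_image\<close> guarantees the suprema in the rank over an infinite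
  type; the injective ray through \<open>y\<close> supplies infinity.\<close>

lemma wf_pred_rel_infinite:
  assumes "wf (pred_rel (\<gamma> :: 'a \<rightharpoonup> 'a))" and "ran \<gamma> \<subseteq> dom \<gamma>" and "y \<in> dom \<gamma>"
  shows "infinite (UNIV :: 'a set)"
proof -
  obtain \<xi> :: "nat \<Rightarrow> 'a" where "inj \<xi>"
    using maximal_right_ray_through[OF assms] maximal_right_ray_inj by blast
  then show ?thesis using finite_imageD[of \<xi> UNIV] finite_subset[of "range \<xi>" UNIV] by auto
qed

lemma pt_rank_less:
  fixes \<gamma> :: "'a \<rightharpoonup> 'a"
  assumes "infinite (UNIV :: 'a set)" and "wf (pred_rel \<gamma>)" and "\<gamma> y = Some x"
  shows "pt_rank \<gamma> y < pt_rank \<gamma> x"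
  using osup_osucc_image(1)[OF assms(1), of y "{y. \<gamma> y = Some x}" "pt_rank \<gamma>"] assms(3)
  by (simp add: pt_rank_unfold[OF assms(2), of x])

text \<open>Together with \<open>pt_rank_less\<close> this makes the rank the least strict upper
  bound of the ranks of the predecessors, which is how the arguments below use it.\<close>

lemma pt_rank_le:
  fixes \<gamma> :: "'a \<rightharpoonup> 'a"
  assumes "infinite (UNIV :: 'a set)" and "wf (pred_rel \<gamma>)"
    and "\<And>y. \<gamma> y = Some x \<Longrightarrow> pt_rank \<gamma> y < b"
  shows "pt_rank \<gamma> x \<le> b"
  using osup_osucc_image(2)[OF assms(1), of "{y. \<gamma> y = Some x}" "pt_rank \<gamma>" b] assms(3)
  by (simp add: pt_rank_unfold[OF assms(2), of x])

text \<open>Predecessors of \<open>x\<close> go to predecessors of \<open>\<phi> x\<close>, whose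
  ranks are large enough by induction.\<close>

lemma map_hom_pt_rank:
  fixes \<alpha> \<beta> :: "'a \<rightharpoonup> 'a"
  assumes inf: "infinite (UNIV :: 'a set)" and wf: "wf (pred_rel \<alpha>)" "wf (pred_rel \<beta>)"
    and hom: "map_hom \<alpha> \<beta> \<phi>"
  shows "pt_rank \<alpha> x \<le> pt_rank \<beta> (\<phi> x)"
  using wf(1)
proof (induction x rule: wf_induct_rule)
  case (less x)
  show ?case
  proof (rule pt_rank_le[OF inf wf(1)])
    fix y assume y: "\<alpha> y = Some x"
    then have "pt_rank \<alpha> y \<le> pt_rank \<beta> (\<phi> y)" using less.IH by (simp add: pred_rel_def)
    also have "\<dots> < pt_rank \<beta> (\<phi> x)"
      using y hom by (intro pt_rank_less[OF inf wf(2)]) (simp add: map_hom_def)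
    finally show "pt_rank \<alpha> y < pt_rank \<beta> (\<phi> x)" .
  qed
qed

section \<open>Domination of rank sequences\<close>

definition dominated_by :: "('a \<rightharpoonup> 'a) \<Rightarrow> ('a \<rightharpoonup> 'a) \<Rightarrow> bool" where
  "dominated_by \<gamma> \<delta> \<longleftrightarrow> (\<exists>\<eta> \<xi>. maximal_right_ray \<eta> \<gamma> \<and> maximal_right_ray \<xi> \<delta> \<and>
     seq_dominates (\<lambda>n. pt_rank \<delta> (\<xi> n)) (\<lambda>n. pt_rank \<gamma> (\<eta> n)))"

text \<open>The image of a ray \<open>\<eta>\<close> need not be maximal, since
  \<open>\<phi> (\<eta> 0)\<close> may have predecessors. It is prolonged backwards to a maximal ray
  \<open>\<xi>\<close>, and the number \<open>k\<close> of added points is the shift in the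
  domination.\<close>

lemma map_hom_dominated:
  fixes \<alpha> \<beta> :: "'a \<rightharpoonup> 'a"
  assumes wf: "wf (pred_rel \<alpha>)" "wf (pred_rel \<beta>)"
    and closed: "ran \<alpha> \<subseteq> dom \<alpha>" "ran \<beta> \<subseteq> dom \<beta>"
    and hom: "map_hom \<alpha> \<beta> \<phi>" and \<gamma>: "\<gamma> \<in> conn_components \<alpha>"
  shows "\<exists>\<delta> \<in> conn_components \<beta>. dominated_by \<gamma> \<delta>"
proof -
  obtain y where y: "y \<in> dom \<gamma>"
    using conn_componentD(1)[OF \<gamma>] unfolding connected_map_def by fastforce
  have inf: "infinite (UNIV :: 'a set)"
    using wf_pred_rel_infinite[OF conn_component_wf[OF wf(1) \<gamma>] conn_component_ran_dom[OF closed(1) \<gamma>] y] .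
  obtain \<eta> where \<eta>: "maximal_right_ray \<eta> \<gamma>"
    using maximal_right_ray_through[OF conn_component_wf[OF wf(1) \<gamma>] conn_component_ran_dom[OF closed(1) \<gamma>] y]
    by blast
  have \<eta>_step: "\<gamma> (\<eta> n) = Some (\<eta> (Suc n))" for n using maximal_right_ray_step[OF \<eta>] .
  have \<phi>_step: "\<beta> (\<phi> (\<eta> n)) = Some (\<phi> (\<eta> (Suc n)))" for n
    using hom conn_component_le[OF \<gamma> \<eta>_step] by (simp add: map_hom_def)
  obtain \<delta> where \<delta>: "\<delta> \<in> conn_components \<beta>" "\<phi> (\<eta> 0) \<in> dom \<delta>"
    using ex_conn_component[of \<beta>, OF \<phi>_step[of 0]] by blast
  obtain \<xi> k where \<xi>: "maximal_right_ray \<xi> \<delta>" "\<xi> k = \<phi> (\<eta> 0)"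
    using maximal_right_ray_through[OF conn_component_wf[OF wf(2) \<delta>(1)]
        conn_component_ran_dom[OF closed(2) \<delta>(1)] \<delta>(2)] by blast
  have \<xi>_step: "\<delta> (\<xi> n) = Some (\<xi> (Suc n))" for n using maximal_right_ray_step[OF \<xi>(1)] .
  have follow: "\<xi> (k + n) = \<phi> (\<eta> n)" for n
  proof (induction n)
    case (Suc n)
    then show ?case
      using conn_component_le[OF \<delta>(1) \<xi>_step[of "k + n"]] \<phi>_step[of n] by simp
  qed (use \<xi>(2) in simp)
  have "pt_rank \<gamma> (\<eta> n) \<le> pt_rank \<delta> (\<xi> (k + n))" for n
  proof -
    have "pt_rank \<gamma> (\<eta> n) = pt_rank \<alpha> (\<eta> n)"
      by (rule pt_rank_component[OF wf(1) \<gamma> tspanI(1)[of \<gamma>, OF \<eta>_step]])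
    also have "\<dots> \<le> pt_rank \<beta> (\<phi> (\<eta> n))" by (rule map_hom_pt_rank[OF inf wf hom])
    also have "\<dots> = pt_rank \<delta> (\<phi> (\<eta> n))"
      using pt_rank_component[OF wf(2) \<delta>(1) tspanI(1)[of \<delta>, OF \<xi>_step[of "k + n"]]] follow by simp
    finally show ?thesis by (simp add: follow)
  qed
  then have "seq_dominates (\<lambda>n. pt_rank \<delta> (\<xi> n)) (\<lambda>n. pt_rank \<gamma> (\<eta> n))"
    unfolding seq_dominates_def by blast
  with \<eta> \<xi>(1) \<delta>(1) show ?thesis unfolding dominated_by_def by blast
qed

text \<open>The homomorphism is the dominating shift on the ray \<open>\<eta>\<close>.  Off the ray it is chosen by recursion on
  the distance to \<open>\<eta>\<close>, keeping the rank of the image at least the rank of the point, which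
  leaves a preimage of sufficient rank at every step.\<close>

lemma dominated_map_hom:
  fixes \<gamma> \<delta> :: "'a \<rightharpoonup> 'a"
  assumes inf: "infinite (UNIV :: 'a set)"
    and wf: "wf (pred_rel \<gamma>)" "wf (pred_rel \<delta>)"
    and conn: "connected_map \<gamma>" and dom: "dominated_by \<gamma> \<delta>"
  shows "\<exists>\<phi>. map_hom \<gamma> \<delta> \<phi>"
proof -
  obtain \<eta> \<xi> k where \<eta>: "maximal_right_ray \<eta> \<gamma>" and \<xi>: "maximal_right_ray \<xi> \<delta>"
    and dom: "\<And>n. pt_rank \<gamma> (\<eta> n) \<le> pt_rank \<delta> (\<xi> (k + n))"
    using dom by (auto simp: dominated_by_def seq_dominates_def)
  have \<eta>_step: "\<gamma> (\<eta> n) = Some (\<eta> (Suc n))" for n using maximal_right_ray_step[OF \<eta>] .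
  have \<xi>_step: "\<delta> (\<xi> n) = Some (\<xi> (Suc n))" for n using maximal_right_ray_step[OF \<xi>] .
  have inv: "inv \<eta> (\<eta> n) = n" for n using maximal_right_ray_inj[OF \<eta>] by simp
  \<comment> \<open>Steps needed to enter the ray. By connectedness the orbit of \<open>y\<close>
    meets that of \<open>\<eta> 0\<close>, which is the ray itself, so the minimum exists on the
    span.\<close>
  define dist where "dist y = (LEAST d. \<exists>n. ppow \<gamma> d y = Some (\<eta> n))" for y
  have reach: "\<exists>n. ppow \<gamma> (dist y) y = Some (\<eta> n)" if y: "y \<in> tspan \<gamma>" for y
  proof -
    obtain d m u where "ppow \<gamma> d y = Some u" "ppow \<gamma> m (\<eta> 0) = Some u"
      using connected_mapE[OF conn y tspanI(1)[of \<gamma>, OF \<eta>_step]] by blast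
    then have "\<exists>n. ppow \<gamma> d y = Some (\<eta> n)"
      using ppow_orbit[of \<gamma> \<eta> m 0] \<eta>_step by auto
    then show ?thesis unfolding dist_def by (rule LeastI)
  qed
  have off_ray: "\<exists>x. \<gamma> y = Some x \<and> dist x < dist y" if y: "y \<in> tspan \<gamma>" "y \<notin> range \<eta>" for y
  proof -
    obtain n where n: "ppow \<gamma> (dist y) y = Some (\<eta> n)" using reach[OF y(1)] by blast
    then have "dist y \<noteq> 0" using y(2) by (metis option.inject ppow.simps(1) rangeI)
    then obtain d where d: "dist y = Suc d" using not0_implies_Suc by blast
    then obtain x where x: "\<gamma> y = Some x" "ppow \<gamma> d x = Some (\<eta> n)"
      using n ppow_Suc_front by metis
    then have "dist x \<le> d" unfolding dist_def[of x] by (intro Least_le) blast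
    with d x(1) show ?thesis by auto
  qed
  \<comment> \<open>The recursion runs against the arrows: off the ray, the value at
    \<open>y\<close> is chosen after the value at its image, which is closer to the ray.\<close>
  define R where "R = {(x, y). y \<in> tspan \<gamma> \<and> y \<notin> range \<eta> \<and> \<gamma> y = Some x}"
  have wf_R: "wf R"
    by (rule wf_subset[OF wf_measure[of dist]]) (use off_ray in \<open>force simp: R_def\<close>)
  \<comment> \<open>\<open>P f y r\<close> says that \<open>r\<close> is an admissible value at
    \<open>y\<close> when \<open>f\<close> gives the value at the image of \<open>y\<close>. On the
    ray, \<open>inv \<eta> y\<close> is the index of \<open>y\<close>; points outside the span are
    unconstrained.\<close>
  define P where "P f y r \<longleftrightarrow> (y \<in> tspan \<gamma> \<longrightarrow> pt_rank \<gamma> y \<le> pt_rank \<delta> r \<and>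
    (if y \<in> range \<eta> then r = \<xi> (k + inv \<eta> y) else \<forall>x. \<gamma> y = Some x \<longrightarrow> \<delta> r = Some (f x)))"
    for f :: "'a \<Rightarrow> 'a" and y r
  have "\<exists>f. \<forall>y. P f y (f y)"
  proof (rule dependent_wf_choice[OF wf_R])
    fix f g :: "'a \<Rightarrow> 'a" and y r
    assume "\<And>z. (z, y) \<in> R \<Longrightarrow> f z = g z"
    then show "P f y r = P g y r" unfolding P_def R_def by auto
  next
    fix y f assume IH: "\<And>z. (z, y) \<in> R \<Longrightarrow> P f z (f z)"
    show "\<exists>r. P f y r"
    proof (cases "y \<in> tspan \<gamma> \<and> y \<notin> range \<eta>")
      case True
      then obtain x where x: "\<gamma> y = Some x" using off_ray by blast
      with True have "P f x (f x)" by (intro IH) (simp add: R_def)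
      then have "pt_rank \<gamma> x \<le> pt_rank \<delta> (f x)" using tspanI(2)[of \<gamma>, OF x] by (simp add: P_def)
      with pt_rank_less[OF inf wf(1) x] have less: "pt_rank \<gamma> y < pt_rank \<delta> (f x)" by simp
      \<comment> \<open>Otherwise all predecessors of \<open>f x\<close> would have rank below that
        of \<open>y\<close>, and \<open>pt_rank_le\<close> would bound the rank of
        \<open>f x\<close> by the rank of \<open>y\<close>.\<close>
      have "\<exists>r. \<delta> r = Some (f x) \<and> pt_rank \<gamma> y \<le> pt_rank \<delta> r"
        using pt_rank_le[OF inf wf(2), of "f x" "pt_rank \<gamma> y"] less by (meson leD not_le)
      with True x show ?thesis by (auto simp: P_def)
    next
      case False
      then show ?thesis using dom by (auto simp: P_def inv)
    qed
  qed
  then obtain f where f: "\<And>y. P f y (f y)" by blast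
  have "\<delta> (f y) = Some (f x)" if yx: "\<gamma> y = Some x" for y x
  proof (cases "y \<in> range \<eta>")
    case True
    then obtain n where n: "y = \<eta> n" by blast
    then have "x = \<eta> (Suc n)" using yx \<eta>_step by simp
    then show ?thesis
      using f[of y] f[of x] tspanI[of \<gamma>, OF yx] n \<xi>_step[of "k + n"] by (simp add: P_def inv)
  next
    case False
    then show ?thesis using f[of y] tspanI(1)[of \<gamma>, OF yx] yx by (simp add: P_def)
  qed
  then have "map_hom \<gamma> \<delta> f" by (simp add: map_hom_def)
  then show ?thesis by blast
qed

lemma ex_map_hom_iff_dominated:
  fixes \<alpha> \<beta> :: "'a \<rightharpoonup> 'a"
  assumes wf: "wf (pred_rel \<alpha>)" "wf (pred_rel \<beta>)"
    and closed: "ran \<alpha> \<subseteq> dom \<alpha>" "ran \<beta> \<subseteq> dom \<beta>"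
  shows "(\<exists>\<phi>. map_hom \<alpha> \<beta> \<phi>) \<longleftrightarrow>
    (\<forall>\<gamma> \<in> conn_components \<alpha>. \<exists>\<delta> \<in> conn_components \<beta>. dominated_by \<gamma> \<delta>)"
proof
  assume "\<exists>\<phi>. map_hom \<alpha> \<beta> \<phi>"
  then show "\<forall>\<gamma> \<in> conn_components \<alpha>. \<exists>\<delta> \<in> conn_components \<beta>. dominated_by \<gamma> \<delta>"
    using map_hom_dominated[OF wf closed] by blast
next
  assume dom: "\<forall>\<gamma> \<in> conn_components \<alpha>. \<exists>\<delta> \<in> conn_components \<beta>. dominated_by \<gamma> \<delta>"
  show "\<exists>\<phi>. map_hom \<alpha> \<beta> \<phi>"
  proof (rule map_hom_glue)
    fix \<gamma> assume \<gamma>: "\<gamma> \<in> conn_components \<alpha>"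
    note wf_\<gamma> = conn_component_wf[OF wf(1) \<gamma>] and conn = conn_componentD(1)[OF \<gamma>]
    obtain y where y: "y \<in> dom \<gamma>" using conn unfolding connected_map_def by fastforce
    have inf: "infinite (UNIV :: 'a set)"
      using wf_pred_rel_infinite[OF wf_\<gamma> conn_component_ran_dom[OF closed(1) \<gamma>] y] .
    obtain \<delta> where \<delta>: "\<delta> \<in> conn_components \<beta>" "dominated_by \<gamma> \<delta>" using dom \<gamma> by blast
    obtain \<phi> where "map_hom \<gamma> \<delta> \<phi>"
      using dominated_map_hom[OF inf wf_\<gamma> conn_component_wf[OF wf(2) \<delta>(1)] conn \<delta>(2)] by blast
    then have "map_hom \<gamma> \<beta> \<phi>" using conn_component_le[OF \<delta>(1)] by (simp add: map_hom_def)
    then show "\<exists>\<phi>. map_hom \<gamma> \<beta> \<phi>" by blast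
  qed
qed


section \<open>Characterization\<close>

lemma exactly_one_iff_disj:
  "\<not> (P \<and> Q) \<Longrightarrow> \<not> (P \<and> R) \<Longrightarrow> \<not> (Q \<and> R) \<Longrightarrow> exactly_one P Q R \<longleftrightarrow> P \<or> Q \<or> R"
  by (auto simp: exactly_one_def)

theorem theorem6p1:
  fixes X :: "'a set" and \<alpha> \<beta> :: "'a \<rightharpoonup> 'a"
  assumes "X \<noteq> {}" and "\<alpha> \<in> full_trans X" and "\<beta> \<in> full_trans X"
  shows "conj_c (full_trans X) pcomp \<alpha> \<beta> \<longleftrightarrow>
    exactly_one
      (has_cycle \<alpha> \<and> has_cycle \<beta> \<and> cyc_set \<alpha> = cyc_set \<beta>)
      (has_double_ray \<alpha> \<and> has_double_ray \<beta> \<and> \<not> has_cycle \<alpha> \<and> \<not> has_cycle \<beta>)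
      ((\<forall>\<gamma> \<in> conn_components \<alpha> \<union> conn_components \<beta>. type_rro \<gamma>) \<and>
       (\<forall>\<gamma> \<in> conn_components \<alpha>. \<exists>\<delta> \<in> conn_components \<beta>. \<exists>\<eta> \<xi>.
          maximal_right_ray \<eta> \<gamma> \<and> maximal_right_ray \<xi> \<delta> \<and>
          seq_dominates (\<lambda>n. pt_rank \<delta> (\<xi> n)) (\<lambda>n. pt_rank \<gamma> (\<eta> n))) \<and>
       (\<forall>\<delta> \<in> conn_components \<beta>. \<exists>\<gamma> \<in> conn_components \<alpha>. \<exists>\<xi> \<eta>.
          maximal_right_ray \<xi> \<delta> \<and> maximal_right_ray \<eta> \<gamma> \<and>
          seq_dominates (\<lambda>n. pt_rank \<gamma> (\<eta> n)) (\<lambda>n. pt_rank \<delta> (\<xi> n))))"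
proof -
  have ran: "ran \<alpha> \<subseteq> dom \<alpha>" "ran \<beta> \<subseteq> dom \<beta>"
    using assms by (auto simp: full_trans_iff)
  let ?hom = "\<lambda>\<alpha> \<beta> :: 'a \<rightharpoonup> 'a. \<exists>\<phi>. map_hom \<alpha> \<beta> \<phi>"
  let ?dom = "\<lambda>\<alpha> \<beta> :: 'a \<rightharpoonup> 'a. \<forall>\<gamma> \<in> conn_components \<alpha>. \<exists>\<delta> \<in> conn_components \<beta>. dominated_by \<gamma> \<delta>"
  let ?A = "has_cycle \<alpha> \<and> has_cycle \<beta> \<and> cyc_set \<alpha> = cyc_set \<beta>"
  let ?B = "has_double_ray \<alpha> \<and> has_double_ray \<beta> \<and> \<not> has_cycle \<alpha> \<and> \<not> has_cycle \<beta>"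
  let ?C = "(\<forall>\<gamma> \<in> conn_components \<alpha> \<union> conn_components \<beta>. type_rro \<gamma>) \<and> ?dom \<alpha> \<beta> \<and> ?dom \<beta> \<alpha>"
  have wf: "wf (pred_rel \<gamma>) \<longleftrightarrow> \<not> has_cycle \<gamma> \<and> \<not> has_double_ray \<gamma>" if "ran \<gamma> \<subseteq> dom \<gamma>" for \<gamma> :: "'a \<rightharpoonup> 'a"
    using ex_biorbit_iff[of \<gamma>] ex_biorbit_iff_not_wf[OF that] by blast
  \<comment> \<open>Type rro of all components amounts to well-foundedness, under which the two
    domination clauses express the two homomorphisms.\<close>
  have C: "?C \<longleftrightarrow> wf (pred_rel \<alpha>) \<and> wf (pred_rel \<beta>) \<and> ?hom \<alpha> \<beta> \<and> ?hom \<beta> \<alpha>"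
    using all_components_rro_iff[OF ran(1)] all_components_rro_iff[OF ran(2)]
      ex_map_hom_iff_dominated[OF _ _ ran] ex_map_hom_iff_dominated[OF _ _ ran(2,1)] by blast
  have "?hom \<alpha> \<beta> \<and> ?hom \<beta> \<alpha> \<longleftrightarrow> ?A \<or> ?B \<or> ?C"
  proof
    assume hom: "?hom \<alpha> \<beta> \<and> ?hom \<beta> \<alpha>"
    then have cyc: "has_cycle \<alpha> \<longleftrightarrow> has_cycle \<beta>" using map_hom_has_cycle by blast
    have bi: "(\<exists>c. biorbit \<alpha> c) \<longleftrightarrow> (\<exists>c. biorbit \<beta> c)" using hom map_hom_biorbit by blast
    \<comment> \<open>This also holds without cycles, when both sets are empty.\<close>
    have "cyc_set \<alpha> = cyc_set \<beta>" unfolding cyc_set_eq_iff using hom map_hom_cycle by blast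
    \<comment> \<open>Both maps have a cycle, or neither has a cycle and both have a bi-infinite
      orbit, hence a double ray, or both are well-founded.\<close>
    then show "?A \<or> ?B \<or> ?C"
      using hom cyc bi unfolding C wf[OF ran(1)] wf[OF ran(2)] ex_biorbit_iff by blast
  next
    assume "?A \<or> ?B \<or> ?C"
    then consider ?A | ?B | ?C by blast
    then show "?hom \<alpha> \<beta> \<and> ?hom \<beta> \<alpha>"
    proof cases
      case 1
      then obtain c d where "biorbit \<alpha> c" "biorbit \<beta> d" using ex_biorbit_iff by blast
      with 1 show ?thesis using map_hom_exists_if_biorbit unfolding cyc_set_eq_iff by metis
    next
      \<comment> \<open>Without cycles the divisibility condition is vacuous, so any bi-infinite
        orbit of the other map can serve as target.\<close>
      case 2
      then obtain c d where "biorbit \<alpha> c" "biorbit \<beta> d" using ex_biorbit_iff by blast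
      with 2 show ?thesis using map_hom_exists_if_biorbit unfolding has_cycle_def by metis
    next
      case 3
      then show ?thesis using C by blast
    qed
  qed
  moreover have "exactly_one ?A ?B ?C \<longleftrightarrow> ?A \<or> ?B \<or> ?C"
  proof (rule exactly_one_iff_disj)
    show "\<not> (?A \<and> ?B)" by blast
    \<comment> \<open>Well-foundedness of \<open>\<alpha>\<close>, which is part of
      \<open>?C\<close>, excludes both its cycles and its double rays.\<close>
    show "\<not> (?A \<and> ?C)" "\<not> (?B \<and> ?C)" unfolding C wf[OF ran(1)] by blast+
  qed
  ultimately have "?hom \<alpha> \<beta> \<and> ?hom \<beta> \<alpha> \<longleftrightarrow> exactly_one ?A ?B ?C" by (rule trans[OF _ sym])
  then show ?thesis
    unfolding conj_c_full_trans_iff[OF assms(2,3)] dominated_by_def .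
qed

end
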